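(* Let $H$ be an infinite-dimensional complex separable Hilbert space and let $T\in\mathcal B(H)$. Then the following are equivalent: (1) $\sigma_{\mathrm{ess}}(T^*T)=\{\alpha\}$ for some $\alpha>0$, and $T^*T$ has only finitely many discrete eigenvalues different from $\alpha$, counted with multiplicity. (2) There exist $\alpha>0$, $F\in\mathcal F(H)$ and a partial isometry $V\in\mathcal B(H)$ with $\dim N(V)<\infty$ such that $T=F+\sqrt{\alpha}\,V$. (3) There exists $\alpha>0$ such that $\alpha I-T^*T\in\mathcal F(H)$. (4) $T$ has closed range, $N(T)$ is finite-dimensional, and there exists $\alpha>0$ such that $\alpha T^\dagger-T^*\in\mathcal F(H)$.
   Context: $\mathcal B(H)$ and $\mathcal F(H)$ denote the bounded and the finite-rank operators on $H$; $N(T)$ and $R(T)$ denote the null space and range of $T$. An operator $A$ is Fredholm if $R(A)$ is closed and $N(A)$, $N(A^* )$ are finite-dimensional; $\sigma_{\mathrm{ess}}(A)=\{\mu\in\mathbb C: A-\mu I\text{ is not Fredholm}\}$. For a self-adjoint operator $A$, the discrete eigenvalues are the isolated points of $\sigma(A)$ that are eigenvalues of finite multiplicity. If $T$ has closed range, the Moore--Penrose inverse $T^\dagger\in\mathcal B(H)$ is the unique operator such that $TT^\dagger$ and $T^\dagger T$ are self-adjoint, $TT^\dagger T=T$ and $T^\dagger TT^\dagger=T^\dagger$. *)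

theory Defs
  imports "HOL-Analysis.Analysis"
begin

text \<open>Positive definiteness of \<open>cinner\<close>, which is linear in its first argument, follows from
  \<open>norm_eq_sqrt_cinner\<close> and the norm axioms.\<close>

class complex_inner = real_normed_vector +
  fixes scaleC :: "complex \<Rightarrow> 'a \<Rightarrow> 'a"  (infixr \<open>*\<^sub>C\<close> 75)
    and cinner :: "'a \<Rightarrow> 'a \<Rightarrow> complex"
  assumes scaleC_add_right: "c *\<^sub>C (x + y) = c *\<^sub>C x + c *\<^sub>C y"
    and scaleC_add_left: "(c + d) *\<^sub>C x = c *\<^sub>C x + d *\<^sub>C x"
    and scaleC_scaleC: "c *\<^sub>C d *\<^sub>C x = (c * d) *\<^sub>C x"
    and scaleR_scaleC: "scaleR r x = complex_of_real r *\<^sub>C x"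
    and cinner_commute: "cinner x y = cnj (cinner y x)"
    and cinner_add_left: "cinner (x + y) z = cinner x z + cinner y z"
    and cinner_scaleC_left: "cinner (c *\<^sub>C x) y = c * cinner x y"
    and norm_eq_sqrt_cinner: "norm x = sqrt (Re (cinner x x))"

class chilbert_space = complex_inner + banach

global_interpretation complex_vector:
    vector_space "scaleC :: complex \<Rightarrow> 'a \<Rightarrow> 'a::complex_inner"
  defines cspan = complex_vector.span
    and cdim = complex_vector.dim
proof
  fix x :: 'a
  show "1 *\<^sub>C x = x"
    using scaleR_scaleC[of 1 x] by simp
qed (simp_all add: scaleC_add_right scaleC_add_left scaleC_scaleC)

text \<open>Applied only to linear subspaces.\<close>
definition finite_cdim :: "'a::complex_inner set \<Rightarrow> bool"
  where "finite_cdim S \<longleftrightarrow> (\<exists>B. finite B \<and> cspan B = S)"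

definition bounded_clinear :: "('a::complex_inner \<Rightarrow> 'a) \<Rightarrow> bool"
  where "bounded_clinear T \<longleftrightarrow> bounded_linear T \<and> (\<forall>c x. T (c *\<^sub>C x) = c *\<^sub>C T x)"

definition null_space :: "('a::complex_inner \<Rightarrow> 'a) \<Rightarrow> 'a set"
  where "null_space T = {x. T x = 0}"

definition finite_rank :: "('a::complex_inner \<Rightarrow> 'a) \<Rightarrow> bool"
  where "finite_rank T \<longleftrightarrow> bounded_clinear T \<and> finite_cdim (range T)"

text \<open>For bounded \<open>T\<close> on a Hilbert space the described operator exists uniquely, by the
  Riesz representation theorem.\<close>
definition cadjoint :: "('a::complex_inner \<Rightarrow> 'a) \<Rightarrow> 'a \<Rightarrow> 'a"
  where "cadjoint T = (THE S. \<forall>x y. cinner (T x) y = cinner x (S y))"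

definition self_adjoint :: "('a::complex_inner \<Rightarrow> 'a) \<Rightarrow> bool"
  where "self_adjoint T \<longleftrightarrow> bounded_clinear T \<and> cadjoint T = T"

definition partial_isometry :: "('a::complex_inner \<Rightarrow> 'a) \<Rightarrow> bool"
  where "partial_isometry V \<longleftrightarrow> bounded_clinear V \<and>
    (\<forall>x. (\<forall>y\<in>null_space V. cinner x y = 0) \<longrightarrow> norm (V x) = norm x)"

definition mp_inverse :: "('a::complex_inner \<Rightarrow> 'a) \<Rightarrow> 'a \<Rightarrow> 'a"
  where "mp_inverse T = (THE S. bounded_clinear S \<and>
    self_adjoint (T \<circ> S) \<and> self_adjoint (S \<circ> T) \<and> T \<circ> S \<circ> T = T \<and> S \<circ> T \<circ> S = S)"

text \<open>The operator \<open>A - \<mu>I\<close>.\<close>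
definition shift_op :: "('a::complex_inner \<Rightarrow> 'a) \<Rightarrow> complex \<Rightarrow> 'a \<Rightarrow> 'a"
  where "shift_op A \<mu> = (\<lambda>x. A x - \<mu> *\<^sub>C x)"

definition op_spectrum :: "('a::complex_inner \<Rightarrow> 'a) \<Rightarrow> complex set"
  where "op_spectrum A =
    {\<mu>. \<not> (\<exists>S. bounded_clinear S \<and> S \<circ> shift_op A \<mu> = id \<and> shift_op A \<mu> \<circ> S = id)}"

definition fredholm :: "('a::complex_inner \<Rightarrow> 'a) \<Rightarrow> bool"
  where "fredholm A \<longleftrightarrow> bounded_clinear A \<and> closed (range A) \<and>
    finite_cdim (null_space A) \<and> finite_cdim (null_space (cadjoint A))"

definition ess_spectrum :: "('a::complex_inner \<Rightarrow> 'a) \<Rightarrow> complex set"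
  where "ess_spectrum A = {\<mu>. \<not> fredholm (shift_op A \<mu>)}"

definition discrete_eigenvalues :: "('a::complex_inner \<Rightarrow> 'a) \<Rightarrow> complex set"
  where "discrete_eigenvalues A = {\<mu>. \<mu> isolated_in op_spectrum A \<and>
    null_space (shift_op A \<mu>) \<noteq> {0} \<and> finite_cdim (null_space (shift_op A \<mu>))}"

text \<open>A discrete eigenvalue of multiplicity \<open>m\<close> contributes \<open>m\<close> pairs, so that cardinalities of
  subsets count eigenvalues with multiplicity.\<close>
definition discrete_eigenvalues_mult :: "('a::complex_inner \<Rightarrow> 'a) \<Rightarrow> (complex \<times> nat) set"
  where "discrete_eigenvalues_mult A =
    (SIGMA \<mu>:discrete_eigenvalues A. {..<cdim (null_space (shift_op A \<mu>))})"

end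

theory Submission
  imports Defs
begin

text \<open>
  All four conditions say that \<open>T\<close> multiplies lengths by \<open>sqrt \<alpha>\<close> on a subspace of finite
  codimension, that is, on \<open>orth_compl B\<close> for some finite set \<open>B\<close>.

  The condition \<open>\<alpha> - T\<^sup>* T\<close> of finite rank says this because the quadratic form of that operator at
  \<open>x\<close> is \<open>\<alpha> (norm x)\<^sup>2 - (norm (T x))\<^sup>2\<close>, and a self-adjoint operator whose form vanishes on a subspace
  of finite codimension has finite rank, by polarization
  (\<open>finite_rank_iff_scales_on_orth_compl\<close>). A decomposition \<open>T = F + sqrt \<alpha> V\<close> says it because
  \<open>F\<close> vanishes and \<open>V\<close> is isometric on such a subspace; conversely, cutting off \<open>T / sqrt \<alpha>\<close> to
  the subspace gives \<open>V\<close> (\<open>scales_on_orth_compl_iff_partial_isometry\<close>).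

  For the Moore--Penrose inverse, \<open>T\<^sup>\<dagger> T\<close> differs from the identity by the projection to the null
  space of \<open>T\<close>, so \<open>(\<alpha> T\<^sup>\<dagger> - T\<^sup>*) T\<close> agrees with \<open>\<alpha> - T\<^sup>* T\<close> up to finite rank; the factor \<open>T\<close> can be
  removed again because \<open>\<alpha> T\<^sup>\<dagger> - T\<^sup>*\<close> vanishes on the orthogonal complement of the range of \<open>T\<close>
  (\<open>finite_rank_iff_mp_inverse\<close>).

  The spectral condition concerns \<open>A = T\<^sup>* T\<close>. If \<open>\<alpha> - A\<close> has finite rank, every \<open>A - \<mu>\<close> with
  \<open>\<mu> \<noteq> \<alpha>\<close> is a nonzero multiple of the identity up to finite rank, hence Fredholm, and
  the eigenvectors for all such \<open>\<mu>\<close> lie in a fixed finite-dimensional space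
  (\<open>ess_spectrum_singleton_if_finite_rank\<close>). Conversely, a real Fredholm point of \<open>A\<close> with nonzero null
  space is a discrete eigenvalue (\<open>isolated_in_op_spectrum_if_fredholm\<close>). On the orthogonal complement
  of the finitely many eigenspaces for \<open>\<mu> \<noteq> \<alpha>\<close>, the self-adjoint operator \<open>A - \<alpha>\<close> therefore has no
  approximate eigenvalue other than \<open>0\<close>. As plus or minus its norm always is an approximate
  eigenvalue, it vanishes there (\<open>self_adjoint_zero_if_shifts_bounded_below\<close>), which makes \<open>\<alpha> - A\<close> an
  operator of finite rank.

  The analysis behind this is Riesz representation, for adjoints, and the open mapping
  theorem, which makes an operator with closed range bounded below on the orthogonal complement of
  its null space.
\<close>

section \<open>Geometry of complex inner product spaces\<close>

lemma cinner_add_right: "cinner x (y + z) = cinner x y + cinner x z"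
  by (metis cinner_add_left cinner_commute complex_cnj_add)

lemma cinner_scaleC_right: "cinner x (c *\<^sub>C y) = cnj c * cinner x y"
  by (metis cinner_commute cinner_scaleC_left complex_cnj_mult)

lemma cinner_zero_left [simp]: "cinner 0 x = 0"
  using cinner_add_left[of 0 0 x] by simp

lemma cinner_zero_right [simp]: "cinner x 0 = 0"
  using cinner_add_right[of x 0 0] by simp

lemma cinner_minus_left: "cinner (- x) y = - cinner x y"
  using cinner_add_left[of x "- x" y] by (simp add: eq_neg_iff_add_eq_0 add.commute)

lemma cinner_minus_right: "cinner x (- y) = - cinner x y"
  using cinner_add_right[of x y "- y"] by (simp add: eq_neg_iff_add_eq_0 add.commute)

lemma cinner_diff_left: "cinner (x - y) z = cinner x z - cinner y z"
  using cinner_add_left[of x "- y" z] by (simp add: cinner_minus_left)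

lemma cinner_diff_right: "cinner x (y - z) = cinner x y - cinner x z"
  using cinner_add_right[of x y "- z"] by (simp add: cinner_minus_right)

lemmas cinner_simps = cinner_add_left cinner_add_right cinner_diff_left cinner_diff_right
  cinner_scaleC_left cinner_scaleC_right cinner_minus_left cinner_minus_right

lemma power2_norm_eq_Re_cinner: "(norm x)\<^sup>2 = Re (cinner x x)"
  by (metis norm_eq_sqrt_cinner norm_ge_zero real_sqrt_ge_0_iff real_sqrt_pow2)

lemma cinner_self: "cinner x x = complex_of_real ((norm x)\<^sup>2)"
proof (rule complex_eqI)
  have "Im (cinner x x) = - Im (cinner x x)"
    by (metis cinner_commute cnj.simps(2))
  then show "Im (cinner x x) = Im (complex_of_real ((norm x)\<^sup>2))" by simp
qed (simp add: power2_norm_eq_Re_cinner)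

lemma cinner_self_eq_0_iff [simp]: "cinner x x = 0 \<longleftrightarrow> x = 0"
  by (simp add: cinner_self)

lemma cinner_eq_0_commute: "cinner x y = 0 \<longleftrightarrow> cinner y x = 0"
  by (metis cinner_commute complex_cnj_zero)

lemma Re_cinner_commute: "Re (cinner x y) = Re (cinner y x)"
  by (metis cinner_commute cnj.simps(1))

lemma cinner_ext:
  assumes "\<And>z. cinner x z = cinner y z"
  shows "x = y"
  by (metis assms cinner_diff_left cinner_self_eq_0_iff eq_iff_diff_eq_0)

lemma cinner_ext_right:
  assumes "\<And>z. cinner z x = cinner z y"
  shows "x = y"
  by (metis assms cinner_diff_right cinner_self_eq_0_iff eq_iff_diff_eq_0)

lemma power2_norm_add: "(norm (x + y))\<^sup>2 = (norm x)\<^sup>2 + 2 * Re (cinner x y) + (norm y)\<^sup>2"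
  by (simp add: power2_norm_eq_Re_cinner cinner_simps Re_cinner_commute[of y x])

lemma power2_norm_diff: "(norm (x - y))\<^sup>2 = (norm x)\<^sup>2 - 2 * Re (cinner x y) + (norm y)\<^sup>2"
  by (simp add: power2_norm_eq_Re_cinner cinner_simps Re_cinner_commute[of y x])

lemma pythagoras:
  assumes "cinner x y = 0"
  shows "(norm (x + y))\<^sup>2 = (norm x)\<^sup>2 + (norm y)\<^sup>2"
  by (simp add: power2_norm_add assms)

lemma norm_le_norm_add_orthogonal:
  assumes "cinner x y = 0"
  shows "norm x \<le> norm (x + y)"
  by (rule power2_le_imp_le) (simp_all add: pythagoras[OF assms])

lemma norm_scaleC: "norm (c *\<^sub>C x) = cmod c * norm x"
proof (rule power2_eq_imp_eq)
  have "complex_of_real ((norm (c *\<^sub>C x))\<^sup>2) = (c * cnj c) * cinner x x"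
    by (simp only: cinner_self[symmetric] cinner_simps mult_ac)
  also have "\<dots> = complex_of_real ((cmod c * norm x)\<^sup>2)"
    by (simp only: complex_norm_square[symmetric] cinner_self of_real_mult[symmetric]
        of_real_power[symmetric] power_mult_distrib)
  finally have "complex_of_real ((norm (c *\<^sub>C x))\<^sup>2) = complex_of_real ((cmod c * norm x)\<^sup>2)" .
  then show "(norm (c *\<^sub>C x))\<^sup>2 = (cmod c * norm x)\<^sup>2"
    using of_real_eq_iff by blast
qed simp_all

text \<open>For the real part the Cauchy--Schwarz inequality is the triangle inequality for
  \<^term>\<open>x + y\<close>, squared; a rotation of \<^term>\<open>x\<close> by a unimodular scalar makes the
  inner product real and nonnegative.\<close>

lemma cauchy_schwarz: "cmod (cinner x y) \<le> norm x * norm y"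
proof (cases "cinner x y = 0")
  case False
  define c where "c = cnj (cinner x y) / cmod (cinner x y)"
  have c: "cmod c = 1"
    using False by (simp add: c_def norm_divide)
  have "cinner (c *\<^sub>C x) y = complex_of_real (cmod (cinner x y))"
    using False complex_norm_square[of "cinner x y"]
    by (simp add: c_def cinner_simps field_simps power2_eq_square)
  then have "cmod (cinner x y) = Re (cinner (c *\<^sub>C x) y)" by simp
  also have "\<dots> \<le> norm (c *\<^sub>C x) * norm y"
  proof -
    have "(norm (c *\<^sub>C x + y))\<^sup>2 \<le> (norm (c *\<^sub>C x) + norm y)\<^sup>2"
      by (intro power_mono norm_triangle_ineq norm_ge_zero)
    then show ?thesis by (simp add: power2_norm_add power2_sum)
  qed
  finally show ?thesis by (simp add: norm_scaleC c)
qed simp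

lemma bounded_linear_cinner_left: "bounded_linear (\<lambda>x. cinner x y)"
  by (rule bounded_linear_intro[where K = "norm y"])
    (simp_all add: cinner_simps scaleR_scaleC scaleR_conv_of_real cauchy_schwarz)

lemma bounded_linear_scaleC_right: "bounded_linear (\<lambda>x. c *\<^sub>C x)"
  by (rule bounded_linear_intro[where K = "cmod c"])
    (simp_all add: scaleC_add_right scaleR_scaleC scaleC_scaleC norm_scaleC mult.commute)

lemma bounded_clinearI:
  assumes "\<And>x y. T (x + y) = T x + T y" "\<And>c x. T (c *\<^sub>C x) = c *\<^sub>C T x"
    and "\<And>x. norm (T x) \<le> norm x * K"
  shows "bounded_clinear T"
  unfolding bounded_clinear_def
  using assms by (auto intro!: bounded_linear_intro[where K = K] simp: scaleR_scaleC)

lemma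
  assumes "bounded_clinear T"
  shows bounded_clinear_bounded_linear: "bounded_linear T"
    and bounded_clinear_scaleC: "T (c *\<^sub>C x) = c *\<^sub>C T x"
    and bounded_clinear_add: "T (x + y) = T x + T y"
    and bounded_clinear_diff: "T (x - y) = T x - T y"
    and bounded_clinear_zero: "T 0 = 0"
proof -
  show "bounded_linear T" "T (c *\<^sub>C x) = c *\<^sub>C T x"
    using assms by (auto simp: bounded_clinear_def)
  then interpret bounded_linear T by simp
  show "T (x + y) = T x + T y" "T (x - y) = T x - T y" "T 0 = 0"
    by (fact add diff zero)+
qed

lemma bounded_clinear_comp:
  assumes "bounded_clinear S" "bounded_clinear T"
  shows "bounded_clinear (S \<circ> T)"
  using assms bounded_linear_compose[of S T] by (auto simp: bounded_clinear_def o_def)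

lemma bounded_clinear_plus:
  assumes "bounded_clinear S" "bounded_clinear T"
  shows "bounded_clinear (\<lambda>x. S x + T x)"
  using assms bounded_linear_add[of S T] by (auto simp: bounded_clinear_def scaleC_add_right)

lemma bounded_clinear_minus:
  assumes "bounded_clinear S" "bounded_clinear T"
  shows "bounded_clinear (\<lambda>x. S x - T x)"
  using assms bounded_linear_sub[of S T]
  by (auto simp: bounded_clinear_def complex_vector.scale_right_diff_distrib)

lemma bounded_clinear_scale:
  assumes "bounded_clinear T"
  shows "bounded_clinear (\<lambda>x. c *\<^sub>C T x)"
  using assms bounded_linear_compose[OF bounded_linear_scaleC_right[of c], of T]
  by (auto simp: bounded_clinear_def scaleC_scaleC mult.commute)

lemma bounded_clinear_id: "bounded_clinear (\<lambda>x. x)"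
  by (simp add: bounded_clinear_def bounded_linear_ident)

lemma bounded_clinear_shift_op:
  assumes "bounded_clinear A"
  shows "bounded_clinear (shift_op A \<mu>)"
  unfolding shift_op_def
  by (intro bounded_clinear_minus bounded_clinear_scale bounded_clinear_id assms)

lemma subspace_range:
  assumes "bounded_clinear T"
  shows "complex_vector.subspace (range T)"
  unfolding complex_vector.subspace_def
  using bounded_clinear_add[OF assms] bounded_clinear_scaleC[OF assms] bounded_clinear_zero[OF assms]
  by (metis (no_types, lifting) rangeE rangeI)

lemma subspace_null_space:
  assumes "bounded_clinear T"
  shows "complex_vector.subspace (null_space T)"
  unfolding complex_vector.subspace_def null_space_def
  by (simp add: bounded_clinear_add[OF assms] bounded_clinear_scaleC[OF assms]
      bounded_clinear_zero[OF assms])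

lemma closed_null_space:
  assumes "bounded_clinear T"
  shows "closed (null_space T)"
  unfolding null_space_def
  by (intro closed_Collect_eq continuous_intros
      linear_continuous_on[OF bounded_clinear_bounded_linear[OF assms]])

definition orth_compl :: "'a::complex_inner set \<Rightarrow> 'a set"
  where "orth_compl S = {x. \<forall>y\<in>S. cinner x y = 0}"

lemma subspace_orth_compl: "complex_vector.subspace (orth_compl S)"
  by (simp add: complex_vector.subspace_def orth_compl_def cinner_simps)

lemma closed_orth_compl: "closed (orth_compl S)"
proof -
  have "closed {x. cinner x y = 0}" for y :: 'a
    by (intro closed_Collect_eq continuous_intros
        linear_continuous_on[OF bounded_linear_cinner_left])
  then have "closed (\<Inter>y\<in>S. {x. cinner x y = 0})" by blast
  also have "(\<Inter>y\<in>S. {x. cinner x y = 0}) = orth_compl S"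
    by (auto simp: orth_compl_def)
  finally show ?thesis .
qed

lemma orth_compl_span: "orth_compl (cspan S) = orth_compl S"
proof
  show "orth_compl (cspan S) \<subseteq> orth_compl S"
    using complex_vector.span_superset by (fastforce simp: orth_compl_def)
  show "orth_compl S \<subseteq> orth_compl (cspan S)"
  proof
    fix x assume x: "x \<in> orth_compl S"
    have "cspan S \<subseteq> {y. cinner x y = 0}"
      using x by (intro complex_vector.span_minimal)
        (auto simp: complex_vector.subspace_def orth_compl_def cinner_simps)
    then show "x \<in> orth_compl (cspan S)" by (auto simp: orth_compl_def)
  qed
qed

lemma cinner_eq_0_spanI:
  assumes "x \<in> orth_compl S" "y \<in> cspan S"
  shows "cinner x y = 0" "cinner y x = 0"
proof -
  show "cinner x y = 0"
    using assms orth_compl_span[of S] by (auto simp: orth_compl_def)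
  then show "cinner y x = 0" by (simp only: cinner_eq_0_commute)
qed

lemma subset_orth_compl_orth_compl: "S \<subseteq> orth_compl (orth_compl S)"
  using cinner_eq_0_commute by (fastforce simp: orth_compl_def)

lemma orth_compl_Int_self:
  assumes "x \<in> S" "x \<in> orth_compl S"
  shows "x = 0"
  using assms by (auto simp: orth_compl_def)

section \<open>Orthogonal projections and adjoints\<close>

lemma parallelogram:
  fixes x y :: "'a::complex_inner"
  shows "(norm (x + y))\<^sup>2 + (norm (x - y))\<^sup>2 = 2 * (norm x)\<^sup>2 + 2 * (norm y)\<^sup>2"
  by (simp add: power2_norm_add power2_norm_diff)

text \<open>A move of the nearest point along a direction of the subspace cannot shorten the connecting
  vector, so that vector has no component in this direction.\<close>

lemma orthogonal_if_nearest:
  assumes M: "complex_vector.subspace M" and p: "p \<in> M"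
    and min: "\<And>q. q \<in> M \<Longrightarrow> norm (x - p) \<le> norm (x - q)"
  shows "x - p \<in> orth_compl M"
proof -
  have "cinner (x - p) y = 0" if y: "y \<in> M" for y
  proof (cases "y = 0")
    case False
    define w where "w = x - p"
    \<comment> \<open>\<open>p + t *\<^sub>C y\<close> is the best approximation to \<open>x\<close> along the line through \<open>p\<close> in direction \<open>y\<close>.\<close>
    define t where "t = cinner w y / cinner y y"
    have "p + t *\<^sub>C y \<in> M"
      using M p y by (simp add: complex_vector.subspace_add complex_vector.subspace_scale)
    from min[OF this] have le: "norm w \<le> norm (w - t *\<^sub>C y)"
      by (simp add: w_def algebra_simps)
    have "cinner (w - t *\<^sub>C y) (t *\<^sub>C y) = 0"
      using False by (simp add: t_def cinner_simps)
    from pythagoras[OF this] have "(norm w)\<^sup>2 = (norm (w - t *\<^sub>C y))\<^sup>2 + (norm (t *\<^sub>C y))\<^sup>2"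
      by simp
    moreover have "(norm w)\<^sup>2 \<le> (norm (w - t *\<^sub>C y))\<^sup>2"
      using le by (simp add: power_mono)
    ultimately have "t *\<^sub>C y = 0" by simp
    then show ?thesis using False by (simp add: t_def w_def)
  qed simp
  then show ?thesis by (auto simp: orth_compl_def)
qed

text \<open>By the parallelogram law, applied to the midpoints of its terms, a sequence in the subspace
  whose distances to \<open>x\<close> approach the infimum is Cauchy. Its limit is a nearest point.\<close>

lemma orthogonal_projection_exists:
  fixes M :: "'a::chilbert_space set"
  assumes M: "complex_vector.subspace M" and cl: "closed M"
  obtains p where "p \<in> M" "x - p \<in> orth_compl M"
proof -
  have 0: "0 \<in> M" using M by (rule complex_vector.subspace_0)
  define d where "d = (INF q\<in>M. (norm (x - q))\<^sup>2)"
  have bdd: "bdd_below ((\<lambda>q. (norm (x - q))\<^sup>2) ` M)"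
    by (rule bdd_belowI[of _ 0]) auto
  have d_le: "d \<le> (norm (x - q))\<^sup>2" if "q \<in> M" for q
    unfolding d_def using bdd that by (rule cINF_lower)
  have "\<exists>q\<in>M. (norm (x - q))\<^sup>2 < d + 1 / Suc n" for n
    using 0 cINF_less_iff[OF _ bdd, of "d + 1 / Suc n"] by (auto simp: d_def)
  then obtain q where q: "\<And>n. q n \<in> M" "\<And>n. (norm (x - q n))\<^sup>2 < d + 1 / Suc n"
    by metis
  have dist: "(norm (q m - q n))\<^sup>2 \<le> 2 / Suc m + 2 / Suc n" for m n
  proof -
    have mid: "(1/2) *\<^sub>R (q m + q n) \<in> M"
      using M q(1) by (simp add: scaleR_scaleC complex_vector.subspace_add
          complex_vector.subspace_scale)
    have "(x - q m) + (x - q n) = 2 *\<^sub>R (x - (1/2) *\<^sub>R (q m + q n))"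
      by (simp add: scaleR_right_diff_distrib scaleR_2)
    then have "4 * d \<le> (norm ((x - q m) + (x - q n)))\<^sup>2"
      using d_le[OF mid] by (simp add: power_mult_distrib)
    moreover have "(norm ((x - q m) + (x - q n)))\<^sup>2 + (norm ((x - q m) - (x - q n)))\<^sup>2
        = 2 * (norm (x - q m))\<^sup>2 + 2 * (norm (x - q n))\<^sup>2"
      by (rule parallelogram)
    moreover have "(norm ((x - q m) - (x - q n)))\<^sup>2 = (norm (q m - q n))\<^sup>2"
      by (simp add: norm_minus_commute)
    moreover have "2 / Suc k = 2 * (1 / Suc k)" for k by simp
    ultimately show ?thesis
      using q(2)[of m] q(2)[of n] by linarith
  qed
  have "Cauchy q"
  proof (rule metric_CauchyI)
    fix e :: real assume "0 < e"
    then obtain N where N: "4 / e\<^sup>2 < real N"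
      using reals_Archimedean2 by blast
    have "dist (q m) (q n) < e" if "m \<ge> N" "n \<ge> N" for m n
    proof -
      have "2 / Suc m \<le> 2 / Suc N" "2 / Suc n \<le> 2 / Suc N"
        using that by (simp_all add: frac_le)
      then have "(norm (q m - q n))\<^sup>2 \<le> 4 / Suc N"
        using dist[of m n] by simp
      also have "\<dots> < e\<^sup>2"
      proof -
        have "4 < e\<^sup>2 * real N" using N \<open>0 < e\<close> by (simp add: field_simps)
        also have "\<dots> \<le> e\<^sup>2 * Suc N" by (simp add: mult_left_mono)
        finally show ?thesis by (simp add: field_simps)
      qed
      finally show ?thesis
        using \<open>0 < e\<close> by (simp add: dist_norm power2_less_imp_less)
    qed
    then show "\<exists>N. \<forall>m\<ge>N. \<forall>n\<ge>N. dist (q m) (q n) < e" by blast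
  qed
  then obtain p where lim: "q \<longlonglongrightarrow> p"
    using Cauchy_convergent convergent_def by blast
  have pM: "p \<in> M" using cl q(1) lim closed_sequentially by blast
  have "(\<lambda>n. d + 1 / Suc n) \<longlonglongrightarrow> d + 0"
    using LIMSEQ_inverse_real_of_nat by (intro tendsto_intros) (simp add: inverse_eq_divide)
  then have lim_d: "(\<lambda>n. d + 1 / Suc n) \<longlonglongrightarrow> d" by simp
  have "(\<lambda>n. (norm (x - q n))\<^sup>2) \<longlonglongrightarrow> (norm (x - p))\<^sup>2"
    by (intro tendsto_intros lim)
  then have "(norm (x - p))\<^sup>2 \<le> d"
    by (rule LIMSEQ_le[OF _ lim_d]) (use q(2) less_imp_le in blast)
  then have "norm (x - p) \<le> norm (x - r)" if "r \<in> M" for r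
    using order_trans[OF _ d_le[OF that]] power2_le_imp_le norm_ge_zero by blast
  with orthogonal_if_nearest[OF M pM] pM show thesis
    using that by blast
qed

lemma orth_compl_orth_compl:
  fixes M :: "'a::chilbert_space set"
  assumes "complex_vector.subspace M" "closed M"
  shows "orth_compl (orth_compl M) = M"
proof
  show "M \<subseteq> orth_compl (orth_compl M)" by (rule subset_orth_compl_orth_compl)
  show "orth_compl (orth_compl M) \<subseteq> M"
  proof
    fix x assume x: "x \<in> orth_compl (orth_compl M)"
    obtain p where p: "p \<in> M" "x - p \<in> orth_compl M"
      using orthogonal_projection_exists[OF assms] .
    have "p \<in> orth_compl (orth_compl M)"
      using subset_orth_compl_orth_compl p(1) by (rule subsetD)
    then have "x - p \<in> orth_compl (orth_compl M)"
      using x subspace_orth_compl complex_vector.subspace_diff by blast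
    then have "x - p = 0" using p(2) orth_compl_Int_self by blast
    then show "x \<in> M" using p(1) by simp
  qed
qed

text \<open>A nonzero functional is determined by its kernel up to a scalar, and a vector orthogonal to
  the kernel represents it.\<close>

lemma riesz_representation:
  fixes f :: "'a::chilbert_space \<Rightarrow> complex"
  assumes f: "bounded_linear f" and fC: "\<And>c x. f (c *\<^sub>C x) = c * f x"
  obtains z where "\<And>x. f x = cinner x z"
proof (cases "\<forall>x. f x = 0")
  case True
  then show thesis using that[of 0] by simp
next
  case False
  then obtain v where v: "f v \<noteq> 0" by blast
  interpret f: bounded_linear f by (fact f)
  define K where "K = {x. f x = 0}"
  have sub: "complex_vector.subspace K"
    by (simp add: complex_vector.subspace_def K_def f.add f.zero fC)
  have cl: "closed K"
    unfolding K_def by (intro closed_Collect_eq continuous_intros linear_continuous_on f)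
  obtain p where p: "p \<in> K" "v - p \<in> orth_compl K"
    using orthogonal_projection_exists[OF sub cl] .
  define w where "w = v - p"
  have fw: "f w \<noteq> 0" using p(1) v by (simp add: w_def f.diff K_def)
  then have w0: "cinner w w \<noteq> 0" using f.zero by (metis cinner_self_eq_0_iff)
  show thesis
  proof
    fix x
    have "f x *\<^sub>C w - f w *\<^sub>C x \<in> K" by (simp add: K_def f.diff fC mult.commute)
    then have "cinner w (f x *\<^sub>C w - f w *\<^sub>C x) = 0"
      using p(2) unfolding orth_compl_def w_def by blast
    then have "cinner (f x *\<^sub>C w - f w *\<^sub>C x) w = 0"
      by (simp only: cinner_eq_0_commute)
    then have "f x * cinner w w = f w * cinner x w"
      by (simp only: cinner_diff_left cinner_scaleC_left right_minus_eq)
    then show "f x = cinner x (cnj (f w / cinner w w) *\<^sub>C w)"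
      using nonzero_eq_divide_eq[OF w0, of "f x" "f w * cinner x w"]
      by (simp only: cinner_scaleC_right complex_cnj_cnj times_divide_eq_left)
  qed
qed

lemma cadjoint_eqI:
  assumes "\<And>x y. cinner (T x) y = cinner x (S y)"
  shows "cadjoint T = S"
  unfolding cadjoint_def
proof (rule the_equality)
  fix R assume R: "\<forall>x y. cinner (T x) y = cinner x (R y)"
  show "R = S"
  proof
    fix y show "R y = S y"
      by (rule cinner_ext_right) (metis R assms)
  qed
qed (use assms in blast)

lemma cinner_cadjoint:
  fixes T :: "'a::chilbert_space \<Rightarrow> 'a"
  assumes T: "bounded_clinear T"
  shows "cinner (T x) y = cinner x (cadjoint T y)"
proof -
  have "\<exists>z. \<forall>x. cinner (T x) y = cinner x z" for y
  proof -
    have "bounded_linear (\<lambda>x. cinner (T x) y)"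
      using bounded_linear_compose[OF bounded_linear_cinner_left bounded_clinear_bounded_linear[OF T]]
      by (simp add: o_def)
    moreover have "cinner (T (c *\<^sub>C x)) y = c * cinner (T x) y" for c x
      by (simp add: bounded_clinear_scaleC[OF T] cinner_scaleC_left)
    ultimately obtain z where "\<And>x. cinner (T x) y = cinner x z"
      using riesz_representation[of "\<lambda>x. cinner (T x) y"] by blast
    then show ?thesis by blast
  qed
  then obtain S where "\<And>x y. cinner (T x) y = cinner x (S y)" by metis
  with cadjoint_eqI show ?thesis by metis
qed

lemma cinner_cadjoint':
  fixes T :: "'a::chilbert_space \<Rightarrow> 'a"
  assumes "bounded_clinear T"
  shows "cinner (cadjoint T x) y = cinner x (T y)"
  by (metis assms cinner_cadjoint cinner_commute)

lemma bounded_clinear_cadjoint: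
  fixes T :: "'a::chilbert_space \<Rightarrow> 'a"
  assumes T: "bounded_clinear T"
  shows "bounded_clinear (cadjoint T)"
proof -
  interpret T: bounded_linear T by (rule bounded_clinear_bounded_linear[OF T])
  note adj = cinner_cadjoint'[OF T]
  obtain K where K: "\<And>x. norm (T x) \<le> norm x * K" "K > 0" using T.pos_bounded by blast
  show ?thesis
  proof (rule bounded_clinearI[where K = K])
    show "cadjoint T (x + y) = cadjoint T x + cadjoint T y" for x y
      by (rule cinner_ext) (simp add: cinner_simps adj)
    show "cadjoint T (c *\<^sub>C x) = c *\<^sub>C cadjoint T x" for c x
      by (rule cinner_ext) (simp add: cinner_simps adj)
    fix x
    have "(norm (cadjoint T x))\<^sup>2 = cmod (cinner x (T (cadjoint T x)))"
      by (metis adj cinner_self norm_of_real abs_power2)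
    also have "\<dots> \<le> norm x * (norm (cadjoint T x) * K)"
      by (meson K(1) cauchy_schwarz mult_left_mono norm_ge_zero order_trans)
    finally have "norm (cadjoint T x) * norm (cadjoint T x) \<le> norm (cadjoint T x) * (norm x * K)"
      by (simp add: power2_eq_square mult_ac)
    then show "norm (cadjoint T x) \<le> norm x * K"
      using K(2) by (cases "cadjoint T x = 0") auto
  qed
qed

lemma self_adjointI:
  assumes "bounded_clinear T" "\<And>x y. cinner (T x) y = cinner x (T y)"
  shows "self_adjoint T"
  by (simp add: assms self_adjoint_def cadjoint_eqI)

lemma self_adjoint_cinner:
  fixes T :: "'a::chilbert_space \<Rightarrow> 'a"
  assumes "self_adjoint T"
  shows "cinner (T x) y = cinner x (T y)"
  using assms cinner_cadjoint by (metis self_adjoint_def)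

lemma self_adjoint_bounded_clinear: "self_adjoint T \<Longrightarrow> bounded_clinear T"
  by (simp add: self_adjoint_def)

lemma self_adjoint_cadjoint_comp:
  fixes T :: "'a::chilbert_space \<Rightarrow> 'a"
  assumes T: "bounded_clinear T"
  shows "self_adjoint (cadjoint T \<circ> T)"
  by (rule self_adjointI)
    (simp_all add: T bounded_clinear_cadjoint bounded_clinear_comp cinner_cadjoint'[OF T]
      cinner_cadjoint[OF T])

lemma null_space_cadjoint:
  fixes T :: "'a::chilbert_space \<Rightarrow> 'a"
  assumes T: "bounded_clinear T"
  shows "null_space (cadjoint T) = orth_compl (range T)"
proof -
  have "cadjoint T x = 0 \<longleftrightarrow> (\<forall>y. cinner (cadjoint T x) y = 0)" for x
    by (metis cinner_zero_left cinner_self_eq_0_iff)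
  then show ?thesis
    by (auto simp: null_space_def orth_compl_def cinner_cadjoint'[OF T])
qed

section \<open>Subspaces of finite dimension and of finite codimension\<close>

lemma finite_cdim_mono:
  assumes "finite_cdim S" "complex_vector.subspace U" "U \<subseteq> S"
  shows "finite_cdim U"
proof -
  obtain C where C: "finite C" "cspan C = S"
    using assms(1) by (auto simp: finite_cdim_def)
  obtain B where B: "B \<subseteq> U" "complex_vector.independent B" "U \<subseteq> cspan B"
    using complex_vector.maximal_independent_subset by blast
  have "finite B"
    using complex_vector.independent_span_bound[OF C(1) B(2)] B(1) assms(3) C(2) by auto
  moreover have "cspan B = U"
    using B complex_vector.span_minimal[OF B(1) assms(2)] by blast
  ultimately show ?thesis by (auto simp: finite_cdim_def)
qed

lemma finite_cdim_span: "finite B \<Longrightarrow> finite_cdim (cspan B)"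
  by (auto simp: finite_cdim_def)

lemma finite_rankI:
  assumes "bounded_clinear T" "finite B" "range T \<subseteq> cspan B"
  shows "finite_rank T"
  using assms finite_cdim_mono[OF finite_cdim_span subspace_range] by (auto simp: finite_rank_def)

lemma finite_rankE:
  assumes "finite_rank T"
  obtains B where "bounded_clinear T" "finite B" "range T = cspan B"
  using assms by (auto simp: finite_rank_def finite_cdim_def)

lemma finite_rank_bounded_clinear: "finite_rank T \<Longrightarrow> bounded_clinear T"
  by (simp add: finite_rank_def)

lemma finite_rank_comp_right:
  assumes "finite_rank F" "bounded_clinear T"
  shows "finite_rank (F \<circ> T)"
proof -
  obtain B where "bounded_clinear F" "finite B" "range F = cspan B"
    using assms(1) by (rule finite_rankE)
  with assms(2) show ?thesis
    by (intro finite_rankI[of _ B] bounded_clinear_comp) auto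
qed

lemma finite_rank_add:
  assumes "finite_rank F" "finite_rank G"
  shows "finite_rank (\<lambda>x. F x + G x)"
proof -
  obtain B where B: "bounded_clinear F" "finite B" "range F = cspan B"
    using assms(1) by (rule finite_rankE)
  obtain C where C: "bounded_clinear G" "finite C" "range G = cspan C"
    using assms(2) by (rule finite_rankE)
  have "F x + G x \<in> cspan (B \<union> C)" for x
  proof (rule complex_vector.span_add)
    show "F x \<in> cspan (B \<union> C)" "G x \<in> cspan (B \<union> C)"
      using B(3) C(3) complex_vector.span_mono[of B "B \<union> C"] complex_vector.span_mono[of C "B \<union> C"]
      by blast+
  qed
  with B C show ?thesis
    by (intro finite_rankI[of _ "B \<union> C"] bounded_clinear_plus) auto
qed

lemma finite_rank_scale:
  assumes "finite_rank F"
  shows "finite_rank (\<lambda>x. c *\<^sub>C F x)"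
proof -
  obtain B where B: "bounded_clinear F" "finite B" "range F = cspan B"
    using assms(1) by (rule finite_rankE)
  then show ?thesis
    by (intro finite_rankI[of _ B] bounded_clinear_scale)
      (auto intro: complex_vector.span_scale)
qed

lemma finite_rank_diff:
  assumes "finite_rank F" "finite_rank G"
  shows "finite_rank (\<lambda>x. F x - G x)"
  using finite_rank_add[OF assms(1) finite_rank_scale[OF assms(2), of "-1"]]
  by (simp add: complex_vector.scale_minus_left)

text \<open>The Gram--Schmidt step: only the component of the new vector orthogonal to the old span
  contributes.\<close>

lemma orthogonal_decomposition_span:
  assumes "finite B"
  obtains p where "p \<in> cspan B" "x - p \<in> orth_compl B"
proof -
  have "\<exists>p\<in>cspan B. x - p \<in> orth_compl B" for x
    using assms
  proof (induction B arbitrary: x rule: finite_induct)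
    case empty
    then show ?case by (simp add: orth_compl_def)
  next
    case (insert b B)
    obtain q where q: "q \<in> cspan B" "b - q \<in> orth_compl B" using insert.IH by blast
    obtain p where p: "p \<in> cspan B" "x - p \<in> orth_compl B" using insert.IH by blast
    define b' where "b' = b - q"
    define c where "c = cinner (x - p) b' / cinner b' b'"
    have sub: "cspan B \<subseteq> cspan (insert b B)"
      by (intro complex_vector.span_mono) auto
    have "b' \<in> cspan (insert b B)"
      unfolding b'_def using q(1) sub
      by (intro complex_vector.span_diff) (auto intro: complex_vector.span_base)
    then have "p + c *\<^sub>C b' \<in> cspan (insert b B)"
      using p(1) sub by (intro complex_vector.span_add complex_vector.span_scale) auto
    moreover have "x - (p + c *\<^sub>C b') \<in> orth_compl (insert b B)"
    proof -
      let ?r = "x - (p + c *\<^sub>C b')"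
      have r: "?r = (x - p) - c *\<^sub>C b'" by simp
      have B: "?r \<in> orth_compl B"
        unfolding r using p(2) q(2) subspace_orth_compl
        by (metis b'_def complex_vector.subspace_diff complex_vector.subspace_scale)
      have "cinner ?r b' = 0"
        unfolding r by (cases "b' = 0") (simp_all add: c_def cinner_simps)
      moreover have "cinner ?r q = 0"
        using B q(1) by (rule cinner_eq_0_spanI)
      ultimately have "cinner ?r b = 0"
        using cinner_add_right[of ?r b' q] by (simp add: b'_def)
      then show ?thesis using B by (simp add: orth_compl_def)
    qed
    ultimately show ?case by blast
  qed
  then show thesis using that by blast
qed

lemma orth_compl_orth_compl_finite:
  assumes "finite B"
  shows "orth_compl (orth_compl B) = cspan B"
proof
  show "cspan B \<subseteq> orth_compl (orth_compl B)"
    by (auto simp: orth_compl_def[of "orth_compl B"] cinner_eq_0_spanI)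
  show "orth_compl (orth_compl B) \<subseteq> cspan B"
  proof
    fix x assume x: "x \<in> orth_compl (orth_compl B)"
    obtain p where p: "p \<in> cspan B" "x - p \<in> orth_compl B"
      using orthogonal_decomposition_span[OF assms] .
    have "p \<in> orth_compl (orth_compl B)"
      using \<open>cspan B \<subseteq> orth_compl (orth_compl B)\<close> p(1) by blast
    then have "x - p \<in> orth_compl (orth_compl B)"
      using x subspace_orth_compl complex_vector.subspace_diff by blast
    then have "x - p = 0" using p(2) orth_compl_Int_self by blast
    then show "x \<in> cspan B" using p(1) by simp
  qed
qed

text \<open>A subspace \<open>S\<close> containing the orthogonal complement of a finite set \<open>B\<close> is determined by
  its intersection with the span of \<open>B\<close>; it is the orthogonal complement of the orthogonal
  complement of that intersection inside the span.\<close>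

lemma closed_subspace_finite_codim:
  assumes S: "complex_vector.subspace S" and B: "finite B" "orth_compl B \<subseteq> S"
  shows "closed S"
proof -
  define D where "D = S \<inter> cspan B"
  have subD: "complex_vector.subspace D"
    using S by (simp add: D_def complex_vector.subspace_inter)
  then obtain C where C: "finite C" "cspan C = D"
    using finite_cdim_mono[OF finite_cdim_span[OF B(1)], of D]
    by (auto simp: D_def finite_cdim_def)
  have "S = orth_compl (cspan B \<inter> orth_compl C)"
  proof
    show "S \<subseteq> orth_compl (cspan B \<inter> orth_compl C)"
    proof
      fix x assume x: "x \<in> S"
      obtain p where p: "p \<in> cspan B" "x - p \<in> orth_compl B"
        using orthogonal_decomposition_span[OF B(1)] .
      have "x - (x - p) \<in> S"
        using S x p(2) B(2) complex_vector.subspace_diff by blast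
      then have pD: "p \<in> cspan C" using p(1) C(2) by (simp add: D_def)
      have "cinner x y = 0" if y: "y \<in> cspan B" "y \<in> orth_compl C" for y
      proof -
        have "cinner p y = 0"
          using y(2) pD by (rule cinner_eq_0_spanI)
        moreover have "cinner (x - p) y = 0"
          using p(2) y(1) by (rule cinner_eq_0_spanI)
        ultimately show ?thesis by (simp add: cinner_diff_left)
      qed
      then show "x \<in> orth_compl (cspan B \<inter> orth_compl C)" by (simp add: orth_compl_def)
    qed
    show "orth_compl (cspan B \<inter> orth_compl C) \<subseteq> S"
    proof
      fix x assume x: "x \<in> orth_compl (cspan B \<inter> orth_compl C)"
      obtain p where p: "p \<in> cspan B" "x - p \<in> orth_compl B"
        using orthogonal_decomposition_span[OF B(1)] .
      obtain d where d: "d \<in> cspan C" "p - d \<in> orth_compl C"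
        using orthogonal_decomposition_span[OF C(1)] .
      have e: "p - d \<in> cspan B"
        using p(1) d(1) C(2) by (intro complex_vector.span_diff) (auto simp: D_def)
      then have "cinner x (p - d) = 0" using x d(2) by (simp add: orth_compl_def)
      moreover have "cinner (x - p) (p - d) = 0"
        using p(2) e by (rule cinner_eq_0_spanI)
      moreover have "cinner d (p - d) = 0"
        using d(2,1) by (rule cinner_eq_0_spanI)
      ultimately have "cinner (p - d) (p - d) = 0"
        by (simp add: cinner_diff_left)
      then have "x = d + (x - p)" by simp
      moreover have "d \<in> S" using d(1) C(2) by (simp add: D_def)
      ultimately show "x \<in> S"
        using S p(2) B(2) complex_vector.subspace_add by (metis subsetD)
    qed
  qed
  then show ?thesis using closed_orth_compl by metis
qed

text \<open>\<open>F x = 0\<close> is tested against a finite spanning set of the range, and the test moves to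
  \<open>x\<close> through the adjoint.\<close>

lemma finite_rank_null_space:
  fixes F :: "'a::chilbert_space \<Rightarrow> 'a"
  assumes "finite_rank F"
  obtains B where "finite B" "orth_compl B = null_space F"
proof -
  obtain C where C: "bounded_clinear F" "finite C" "range F = cspan C"
    using assms by (rule finite_rankE)
  have "x \<in> orth_compl (cadjoint F ` C) \<longleftrightarrow> F x = 0" for x
  proof -
    have "x \<in> orth_compl (cadjoint F ` C) \<longleftrightarrow> F x \<in> orth_compl (cspan C)"
      unfolding orth_compl_span by (simp add: orth_compl_def cinner_cadjoint[OF C(1)])
    also have "\<dots> \<longleftrightarrow> F x = 0"
      using C(3) orth_compl_Int_self[of "F x" "cspan C"]
      by (auto simp: orth_compl_def)
    finally show ?thesis .
  qed
  then show thesis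
    using that[of "cadjoint F ` C"] C(2) by (auto simp: null_space_def)
qed

text \<open>The orthogonal complement of \<open>B\<close> contributes values in the span of \<open>C\<close>, and the span of \<open>B\<close>
  contributes only finitely many further dimensions.\<close>

lemma finite_rank_if_orth_compl_maps_to_span:
  assumes T: "bounded_clinear T" and B: "finite B"
    and C: "finite C" "\<And>x. x \<in> orth_compl B \<Longrightarrow> T x \<in> cspan C"
  shows "finite_rank T"
proof (rule finite_rankI[OF T])
  show "finite (C \<union> T ` B)" using B C(1) by simp
  show "range T \<subseteq> cspan (C \<union> T ` B)"
  proof safe
    fix x
    obtain p where p: "p \<in> cspan B" "x - p \<in> orth_compl B"
      using orthogonal_decomposition_span[OF B] .
    have "cspan B \<subseteq> {y. T y \<in> cspan (C \<union> T ` B)}"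
      by (rule complex_vector.span_minimal)
        (auto simp: complex_vector.subspace_def bounded_clinear_add[OF T]
          bounded_clinear_scaleC[OF T] bounded_clinear_zero[OF T] complex_vector.span_zero
          intro: complex_vector.span_base complex_vector.span_add complex_vector.span_scale)
    then have "T p \<in> cspan (C \<union> T ` B)" using p(1) by blast
    moreover have "T (x - p) \<in> cspan (C \<union> T ` B)"
      using C(2)[OF p(2)] complex_vector.span_mono[of C "C \<union> T ` B"] by blast
    ultimately have "T (x - p) + T p \<in> cspan (C \<union> T ` B)"
      by (intro complex_vector.span_add)
    then show "T x \<in> cspan (C \<union> T ` B)"
      by (simp add: bounded_clinear_diff[OF T])
  qed
qed

section \<open>Operators with closed range\<close>

text \<open>The classical open mapping argument, run in the complete subspace \<open>range T\<close>.
  By Baire, the closure of the image of some ball has interior points relative to the range;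
  subtracting two of them solves \<open>T x = y\<close> approximately with control of \<open>norm x\<close>.\<close>

lemma approximate_preimage:
  fixes T :: "'a::banach \<Rightarrow> 'b::banach"
  assumes T: "bounded_linear T" and cl: "closed (range T)"
  obtains C where "C > 0" and
    "\<And>y e. y \<in> range T \<Longrightarrow> e > 0 \<Longrightarrow> \<exists>x. norm x \<le> C * norm y \<and> norm (y - T x) < e"
proof -
  interpret T: bounded_linear T by (fact T)
  let ?X = "top_of_set (range T)"
  let ?G = "range (\<lambda>n::nat. closure (T ` cball 0 (real n)))"
  have sub: "closure (T ` cball 0 (real n)) \<subseteq> range T" for n
    using cl by (simp add: closure_minimal image_mono)
  have "range T \<subseteq> \<Union>?G"
  proof
    fix y assume "y \<in> range T"
    then obtain x where y: "y = T x" by blast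
    obtain n where "norm x \<le> real n" using real_arch_simple by blast
    then have "y \<in> T ` cball 0 (real n)" by (simp add: y)
    then show "y \<in> \<Union>?G"
      using closure_subset[of "T ` cball 0 (real n)"]
      by (intro UnionI[of "closure (T ` cball 0 (real n))"]) auto
  qed
  then have "\<Union>?G = range T"
    using sub by (simp add: subset_antisym UN_least)
  then have "?X interior_of \<Union>?G = range T"
    using interior_of_topspace[of ?X] by simp
  moreover have "0 \<in> range T" using T.zero by (metis rangeI)
  ultimately have "?X interior_of \<Union>?G \<noteq> {}" by auto
  moreover have "completely_metrizable_space ?X"
    using cl by (simp add: completely_metrizable_space_closedin completely_metrizable_space_euclidean)
  moreover have "closedin ?X (closure (T ` cball 0 (real n)))" for n
    using sub by (simp add: closed_subset)
  ultimately obtain n where n: "?X interior_of closure (T ` cball 0 (real n)) \<noteq> {}"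
    using Baire_category_alt[of ?X ?G] by (auto simp del: interior_of_eq_empty)
  then obtain y0 U where U: "openin ?X U" "y0 \<in> U" "U \<subseteq> closure (T ` cball 0 (real n))"
    by (auto simp: interior_of_def)
  then have y0: "y0 \<in> range T"
    and "\<exists>\<delta>>0. ball y0 \<delta> \<inter> range T \<subseteq> U"
    unfolding openin_contains_ball by blast+
  then obtain \<delta> where \<delta>: "\<delta> > 0" "ball y0 \<delta> \<inter> range T \<subseteq> U" by blast
  have near: "\<exists>x. norm x \<le> 2 * real n \<and> norm (y - T x) < e"
    if y: "y \<in> range T" "norm y < \<delta>" and e: "e > 0" for y e
  proof -
    have "y0 + y \<in> range T" using y0 y(1) by (auto simp flip: T.add)
    then have "y0 + y \<in> closure (T ` cball 0 (real n))"
      using y(2) \<delta>(2) U(3) by (auto simp: dist_norm subset_iff)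
    then obtain a where a: "norm a \<le> real n" "dist (T a) (y0 + y) < e / 2"
      unfolding closure_approachable using e half_gt_zero[OF e] by fastforce
    have "y0 \<in> closure (T ` cball 0 (real n))" using U by blast
    then obtain b where b: "norm b \<le> real n" "dist (T b) y0 < e / 2"
      unfolding closure_approachable using e half_gt_zero[OF e] by fastforce
    have "norm (y - T (a - b)) = norm ((T b - y0) - (T a - (y0 + y)))"
      by (simp add: T.diff algebra_simps)
    also have "\<dots> \<le> norm (T b - y0) + norm (T a - (y0 + y))"
      by (rule norm_triangle_ineq4)
    also have "\<dots> < e" using a(2) b(2) by (simp add: dist_norm)
    finally show ?thesis
      using a(1) b(1) norm_triangle_ineq4[of a b] by (intro exI[of _ "a - b"]) auto
  qed
  define C where "C = (2 * (2 * real n + 1)) / \<delta>"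
  show thesis
  proof
    show "C > 0" using \<delta>(1) by (simp add: C_def)
    fix y e assume y: "y \<in> range T" and e: "(e::real) > 0"
    show "\<exists>x. norm x \<le> C * norm y \<and> norm (y - T x) < e"
    proof (cases "y = 0")
      case True
      then show ?thesis using e by (intro exI[of _ 0]) (simp add: T.zero)
    next
      case False
      \<comment> \<open>Rescale \<open>y\<close> to norm \<open>\<delta> / 2\<close>.\<close>
      define t where "t = \<delta> / (2 * norm y)"
      have t: "t > 0" using False \<delta>(1) by (simp add: t_def)
      have "t *\<^sub>R y \<in> range T" using y by (auto simp flip: T.scaleR)
      moreover have "norm (t *\<^sub>R y) < \<delta>" using False \<delta>(1) by (simp add: t_def)
      ultimately obtain x where x: "norm x \<le> 2 * real n" "norm (t *\<^sub>R y - T x) < t * e"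
        using near[of "t *\<^sub>R y" "t * e"] t e by auto
      have "t *\<^sub>R (y - T (x /\<^sub>R t)) = t *\<^sub>R y - T x"
        using t by (simp add: T.scaleR scaleR_right_diff_distrib)
      then have "t * norm (y - T (x /\<^sub>R t)) < t * e"
        using x(2) t by (metis abs_of_pos norm_scaleR)
      moreover have "norm (x /\<^sub>R t) \<le> C * norm y"
      proof -
        have "norm (x /\<^sub>R t) = norm x / t" using t by (simp add: field_simps)
        also have "\<dots> \<le> (2 * real n + 1) / t"
          using x(1) t by (intro divide_right_mono) auto
        also have "\<dots> = C * norm y" by (simp add: t_def C_def)
        finally show ?thesis .
      qed
      ultimately show ?thesis using t by (intro exI[of _ "x /\<^sub>R t"]) simp
    qed
  qed
qed

text \<open>Successive approximation: each step halves the residual, so the corrections form a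
  geometrically convergent series.\<close>

lemma bounded_preimage:
  fixes T :: "'a::banach \<Rightarrow> 'b::banach"
  assumes T: "bounded_linear T" and cl: "closed (range T)"
  obtains C where "C > 0" and "\<And>y. y \<in> range T \<Longrightarrow> \<exists>x. T x = y \<and> norm x \<le> C * norm y"
proof -
  interpret T: bounded_linear T by (fact T)
  obtain C where C: "C > 0"
    and app: "\<And>y e. y \<in> range T \<Longrightarrow> e > 0 \<Longrightarrow> \<exists>x. norm x \<le> C * norm y \<and> norm (y - T x) < e"
    using approximate_preimage[OF T cl] by metis
  have "\<exists>x. norm x \<le> C * norm y \<and> norm (y - T x) \<le> norm y / 2" if "y \<in> range T" for y
  proof (cases "y = 0")
    case True
    then show ?thesis by (intro exI[of _ 0]) (simp add: T.zero)
  next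
    case False
    then show ?thesis using app[OF that, of "norm y / 2"] less_imp_le by fastforce
  qed
  then obtain g where g: "\<And>y. y \<in> range T \<Longrightarrow> norm (g y) \<le> C * norm y"
    "\<And>y. y \<in> range T \<Longrightarrow> norm (y - T (g y)) \<le> norm y / 2" by metis
  show thesis
  proof
    show "2 * C > 0" using C by simp
    fix y assume y: "y \<in> range T"
    define r where "r k = ((\<lambda>y. y - T (g y)) ^^ k) y" for k
    have r_Suc: "r (Suc k) = r k - T (g (r k))" and r_0: "r 0 = y" for k
      by (simp_all add: r_def)
    have r: "r k \<in> range T \<and> norm (r k) \<le> norm y * (1/2) ^ k" for k
    proof (induction k)
      case 0
      then show ?case using y by (simp add: r_0)
    next
      case (Suc k)
      obtain u where "r k = T u" using Suc by blast
      then have "r (Suc k) = T (u - g (r k))" by (simp add: r_Suc T.diff)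
      then have "r (Suc k) \<in> range T" by blast
      then show ?case using Suc g(2)[of "r k"] by (simp add: r_Suc)
    qed
    have bound: "norm (g (r k)) \<le> C * norm y * (1/2) ^ k" for k
    proof -
      have "norm (g (r k)) \<le> C * norm (r k)" using g(1) r by blast
      also have "\<dots> \<le> C * (norm y * (1/2) ^ k)"
        using r[of k] C by (intro mult_left_mono) auto
      finally show ?thesis by (simp add: mult_ac)
    qed
    have geo: "(\<lambda>k. C * norm y * (1/2::real) ^ k) sums (C * norm y * 2)"
      using geometric_sums[of "1/2::real"] by (intro sums_mult) simp
    then have sm: "summable (\<lambda>k. C * norm y * (1/2::real) ^ k)" by (rule sums_summable)
    then have abs: "summable (\<lambda>k. norm (g (r k)))"
      by (rule summable_comparison_test'[where N = 0]) (simp add: bound)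
    let ?x = "\<Sum>k. g (r k)"
    have "norm ?x \<le> (\<Sum>k. norm (g (r k)))" using abs by (rule summable_norm)
    also have "\<dots> \<le> (\<Sum>k. C * norm y * (1/2) ^ k)"
      by (rule suminf_le[OF bound abs sm])
    also have "\<dots> = C * norm y * 2" using geo by (rule sums_unique[symmetric])
    finally have 1: "norm ?x \<le> 2 * C * norm y" by simp
    have "(\<lambda>k. T (g (r k))) sums T ?x"
      by (rule T.sums[OF summable_sums[OF summable_norm_cancel[OF abs]]])
    moreover have "r \<longlonglongrightarrow> 0"
    proof (rule Lim_null_comparison)
      show "\<forall>\<^sub>F k in sequentially. norm (r k) \<le> norm y * (1/2) ^ k" using r by simp
      show "(\<lambda>k. norm y * (1/2::real) ^ k) \<longlonglongrightarrow> 0"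
        by (intro tendsto_mult_right_zero LIMSEQ_power_zero) simp
    qed
    then have "(\<lambda>k. r k - r (Suc k)) sums (r 0 - 0)" by (rule telescope_sums')
    then have "(\<lambda>k. T (g (r k))) sums y" by (simp add: r_Suc r_0)
    ultimately have "T ?x = y" by (rule sums_unique2)
    with 1 show "\<exists>x. T x = y \<and> norm x \<le> 2 * C * norm y" by blast
  qed
qed

text \<open>A vector orthogonal to the null space is the shortest among all preimages of its image.\<close>

lemma bounded_below_if_closed_range:
  fixes T :: "'a::chilbert_space \<Rightarrow> 'a"
  assumes T: "bounded_clinear T" and cl: "closed (range T)"
  obtains c where "c > 0" "\<And>x. x \<in> orth_compl (null_space T) \<Longrightarrow> c * norm x \<le> norm (T x)"
proof -
  obtain C where C: "C > 0" "\<And>y. y \<in> range T \<Longrightarrow> \<exists>x. T x = y \<and> norm x \<le> C * norm y"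
    using bounded_preimage[OF bounded_clinear_bounded_linear[OF T] cl] by blast
  show thesis
  proof
    show "1 / C > 0" using C(1) by simp
    fix x assume x: "x \<in> orth_compl (null_space T)"
    obtain z where z: "T z = T x" "norm z \<le> C * norm (T x)" using C(2) by blast
    have "z - x \<in> null_space T" by (simp add: null_space_def bounded_clinear_diff[OF T] z(1))
    then have "cinner x (z - x) = 0" using x by (simp add: orth_compl_def)
    from norm_le_norm_add_orthogonal[OF this] have "norm x \<le> norm z" by simp
    with z(2) C(1) show "1 / C * norm x \<le> norm (T x)" by (simp add: field_simps)
  qed
qed

section \<open>The Moore--Penrose inverse\<close>

text \<open>\<open>T R\<close> and \<open>T S\<close> are both the orthogonal projection to the range of \<open>T\<close>, and \<open>R T\<close> and \<open>S T\<close>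
  are both the one to the orthogonal complement of its null space; \<open>R = R T R\<close> is built from these.\<close>

lemma mp_inverse_unique:
  fixes T :: "'a::chilbert_space \<Rightarrow> 'a"
  assumes R: "self_adjoint (T \<circ> R)" "self_adjoint (R \<circ> T)" "T \<circ> R \<circ> T = T" "R \<circ> T \<circ> R = R"
    and S: "self_adjoint (T \<circ> S)" "self_adjoint (S \<circ> T)" "T \<circ> S \<circ> T = T" "S \<circ> T \<circ> S = S"
  shows "R = S"
proof -
  have Rx: "T (R (T x)) = T x" "R (T (R x)) = R x" for x
    using fun_cong[OF R(3), of x] fun_cong[OF R(4), of x] by simp_all
  have Sx: "T (S (T x)) = T x" "S (T (S x)) = S x" for x
    using fun_cong[OF S(3), of x] fun_cong[OF S(4), of x] by simp_all
  note sym = self_adjoint_cinner[OF R(1), simplified] self_adjoint_cinner[OF R(2), simplified]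
    self_adjoint_cinner[OF S(1), simplified] self_adjoint_cinner[OF S(2), simplified]
  \<comment> \<open>Two self-adjoint idempotents \<open>P\<close>, \<open>Q\<close> with \<open>P Q = Q\<close> and \<open>Q P = P\<close> agree.\<close>
  have TR: "T (R x) = T (S x)" for x
  proof (rule cinner_ext)
    fix z
    have "cinner (T (R x)) z = cinner x (T (R z))" by (rule sym)
    also have "\<dots> = cinner x (T (S (T (R z))))" by (simp add: Sx)
    also have "\<dots> = cinner (T (R (T (S x)))) z" by (simp add: sym)
    also have "\<dots> = cinner (T (S x)) z" by (simp add: Rx)
    finally show "cinner (T (R x)) z = cinner (T (S x)) z" .
  qed
  have RT: "R (T x) = S (T x)" for x
  proof (rule cinner_ext)
    fix z
    have "cinner (R (T x)) z = cinner (R (T (S (T x)))) z" by (simp add: Sx)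
    also have "\<dots> = cinner x (S (T (R (T z))))" by (simp add: sym)
    also have "\<dots> = cinner x (S (T z))" by (simp add: Rx)
    also have "\<dots> = cinner (S (T x)) z" by (simp add: sym)
    finally show "cinner (R (T x)) z = cinner (S (T x)) z" .
  qed
  show ?thesis
  proof
    fix x show "R x = S x" by (metis RT TR Rx(2) Sx(2))
  qed
qed

text \<open>The inverse sends \<open>y\<close> to the preimage, orthogonal to the null space, of the projection of \<open>y\<close>
  to the range; \<open>rel y x\<close> expresses this relation. The lower bound for \<open>T\<close> makes it bounded.\<close>

lemma mp_inverse_exists:
  fixes T :: "'a::chilbert_space \<Rightarrow> 'a"
  assumes T: "bounded_clinear T" and cl: "closed (range T)"
  obtains S where "bounded_clinear S" "self_adjoint (T \<circ> S)" "self_adjoint (S \<circ> T)"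
    "T \<circ> S \<circ> T = T" "S \<circ> T \<circ> S = S"
proof -
  obtain c where c: "c > 0" "\<And>x. x \<in> orth_compl (null_space T) \<Longrightarrow> c * norm x \<le> norm (T x)"
    using bounded_below_if_closed_range[OF T cl] by blast
  define rel where "rel y x \<longleftrightarrow> x \<in> orth_compl (null_space T) \<and> y - T x \<in> orth_compl (range T)"
    for y x
  note T_simps = bounded_clinear_add[OF T] bounded_clinear_diff[OF T] bounded_clinear_scaleC[OF T]
    bounded_clinear_zero[OF T]
  have ex: "\<exists>x. rel y x" for y
  proof -
    obtain q where q: "q \<in> range T" "y - q \<in> orth_compl (range T)"
      using orthogonal_projection_exists[OF subspace_range[OF T] cl] .
    then obtain u where u: "q = T u" by blast
    obtain p where p: "p \<in> null_space T" "u - p \<in> orth_compl (null_space T)"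
      using orthogonal_projection_exists[OF subspace_null_space[OF T] closed_null_space[OF T]] .
    have "T (u - p) = q" using p(1) by (simp add: T_simps u null_space_def)
    with p(2) q(2) show ?thesis by (auto simp: rel_def)
  qed
  have uniq: "x = x'" if "rel y x" "rel y x'" for y x x'
  proof -
    have "(y - T x') - (y - T x) \<in> orth_compl (range T)"
      using that subspace_orth_compl complex_vector.subspace_diff unfolding rel_def by blast
    then have "T (x - x') \<in> orth_compl (range T)" by (simp add: T_simps)
    then have "T (x - x') = 0" by (rule orth_compl_Int_self[OF rangeI])
    then have "x - x' \<in> null_space T" by (simp add: null_space_def)
    moreover have "x - x' \<in> orth_compl (null_space T)"
      using that subspace_orth_compl complex_vector.subspace_diff unfolding rel_def by blast
    ultimately have "x - x' = 0" by (rule orth_compl_Int_self)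
    then show ?thesis by simp
  qed
  obtain S where S: "\<And>y. rel y (S y)" using ex by metis
  have S1: "cinner (S y) z = 0" if "z \<in> null_space T" for y z
    using S that by (auto simp: rel_def orth_compl_def)
  have S2: "cinner (y - T (S y)) (T z) = 0" for y z
    using S by (auto simp: rel_def orth_compl_def)
  have TST: "T (S (T x)) = T x" for x
  proof -
    have "cinner (T x - T (S (T x))) (T (x - S (T x))) = 0" by (rule S2)
    then show ?thesis by (simp add: T_simps)
  qed
  have STS: "S (T (S y)) = S y" for y
  proof (rule uniq)
    show "rel (T (S y)) (S (T (S y)))" by (rule S)
    show "rel (T (S y)) (S y)" using S[of y] by (simp add: rel_def orth_compl_def)
  qed
  have bS: "bounded_clinear S"
  proof (rule bounded_clinearI[where K = "1 / c"])
    show "S (x + y) = S x + S y" for x y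
    proof (rule uniq[OF S])
      have "(x - T (S x)) + (y - T (S y)) \<in> orth_compl (range T)"
        using S subspace_orth_compl complex_vector.subspace_add unfolding rel_def by blast
      moreover have "(x - T (S x)) + (y - T (S y)) = x + y - T (S x + S y)"
        by (simp add: T_simps)
      ultimately show "rel (x + y) (S x + S y)"
        using S subspace_orth_compl complex_vector.subspace_add unfolding rel_def by metis
    qed
    show "S (a *\<^sub>C x) = a *\<^sub>C S x" for a x
    proof (rule uniq[OF S])
      have "a *\<^sub>C (x - T (S x)) \<in> orth_compl (range T)"
        using S subspace_orth_compl complex_vector.subspace_scale unfolding rel_def by blast
      moreover have "a *\<^sub>C (x - T (S x)) = a *\<^sub>C x - T (a *\<^sub>C S x)"
        by (simp add: T_simps complex_vector.scale_right_diff_distrib)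
      ultimately show "rel (a *\<^sub>C x) (a *\<^sub>C S x)"
        using S subspace_orth_compl complex_vector.subspace_scale unfolding rel_def by metis
    qed
    show "norm (S x) \<le> norm x * (1 / c)" for x
    proof -
      have "c * norm (S x) \<le> norm (T (S x))" using c(2) S by (simp add: rel_def)
      also have "\<dots> \<le> norm (T (S x) + (x - T (S x)))"
        by (rule norm_le_norm_add_orthogonal) (metis S2 cinner_eq_0_commute)
      finally show ?thesis using c(1) by (simp add: field_simps)
    qed
  qed
  have sym: "cinner (P x) y = cinner x (P y)"
    if "\<And>x y. cinner (x - P x) (P y) = 0" for P :: "'a \<Rightarrow> 'a" and x y
  proof -
    have "cinner x (P y) = cinner (P x) (P y)" using that[of x y] by (simp add: cinner_diff_left)
    also have "\<dots> = cnj (cinner (P y) (P x))" by (rule cinner_commute)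
    also have "\<dots> = cnj (cinner y (P x))" using that[of y x] by (simp add: cinner_diff_left)
    also have "\<dots> = cinner (P x) y" by (rule cinner_commute[symmetric])
    finally show ?thesis by simp
  qed
  show thesis
  proof
    show "bounded_clinear S" by (fact bS)
    show "self_adjoint (T \<circ> S)"
    proof (rule self_adjointI)
      show "cinner ((T \<circ> S) x) y = cinner x ((T \<circ> S) y)" for x y
        by (rule sym) (simp add: S2)
    qed (simp add: bounded_clinear_comp T bS)
    show "self_adjoint (S \<circ> T)"
    proof (rule self_adjointI)
      have "cinner (x - S (T x)) (S (T y)) = 0" for x y
        using S1[of "x - S (T x)" "T y"] cinner_eq_0_commute
        by (auto simp: null_space_def T_simps TST)
      then show "cinner ((S \<circ> T) x) y = cinner x ((S \<circ> T) y)" for x y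
        by (intro sym) simp
    qed (simp add: bounded_clinear_comp T bS)
    show "T \<circ> S \<circ> T = T" "S \<circ> T \<circ> S = S" by (auto simp: TST STS)
  qed
qed

lemma mp_inverse_properties:
  fixes T :: "'a::chilbert_space \<Rightarrow> 'a"
  assumes "bounded_clinear T" "closed (range T)"
  shows "bounded_clinear (mp_inverse T) \<and> self_adjoint (T \<circ> mp_inverse T) \<and>
    self_adjoint (mp_inverse T \<circ> T) \<and> T \<circ> mp_inverse T \<circ> T = T \<and>
    mp_inverse T \<circ> T \<circ> mp_inverse T = mp_inverse T"
proof -
  define P where "P S \<longleftrightarrow> bounded_clinear S \<and> self_adjoint (T \<circ> S) \<and> self_adjoint (S \<circ> T) \<and>
    T \<circ> S \<circ> T = T \<and> S \<circ> T \<circ> S = S" for S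
  have "\<exists>!S. P S"
    using mp_inverse_exists[OF assms] mp_inverse_unique[of T] unfolding P_def by metis
  from theI'[OF this] have "P (mp_inverse T)"
    by (simp add: P_def mp_inverse_def)
  then show ?thesis by (simp add: P_def)
qed

section \<open>Fredholm points of self-adjoint operators\<close>

lemma cinner_shift_op:
  fixes A :: "'a::chilbert_space \<Rightarrow> 'a"
  assumes "self_adjoint A"
  shows "cinner (shift_op A \<mu> x) y = cinner x (shift_op A (cnj \<mu>) y)"
  by (simp add: shift_op_def cinner_simps self_adjoint_cinner[OF assms])

lemma cadjoint_shift_op:
  fixes A :: "'a::chilbert_space \<Rightarrow> 'a"
  assumes "self_adjoint A"
  shows "cadjoint (shift_op A \<mu>) = shift_op A (cnj \<mu>)"
  by (rule cadjoint_eqI) (rule cinner_shift_op[OF assms])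

lemma null_space_shift_op: "x \<in> null_space (shift_op A \<mu>) \<longleftrightarrow> A x = \<mu> *\<^sub>C x"
  by (simp add: null_space_def shift_op_def)

text \<open>The lower bound makes the range complete, hence closed, so a range with trivial orthogonal
  complement is everything.\<close>

lemma invertible_if_bounded_below:
  fixes B :: "'a::chilbert_space \<Rightarrow> 'a"
  assumes B: "bounded_clinear B" and c: "c > 0" "\<And>x. c * norm x \<le> norm (B x)"
    and dense: "orth_compl (range B) \<subseteq> {0}"
  shows "\<exists>S. bounded_clinear S \<and> S \<circ> B = id \<and> B \<circ> S = id"
proof -
  have "complete (range B)"
    by (rule complete_isometric_image[OF c(1) subspace_UNIV bounded_clinear_bounded_linear[OF B]])
      (simp_all add: c(2) complete_UNIV)
  then have "closed (range B)" by (rule complete_imp_closed)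
  then have "range B = orth_compl (orth_compl (range B))"
    using orth_compl_orth_compl[OF subspace_range[OF B]] by simp
  also have "\<dots> = UNIV" using dense by (auto simp: orth_compl_def[of "orth_compl (range B)"])
  finally have surj: "range B = UNIV" .
  have inj: "inj B"
  proof (rule injI)
    fix x y assume "B x = B y"
    then show "x = y" using c(2)[of "x - y"] c(1)
      by (simp add: bounded_clinear_diff[OF B] mult_le_0_iff)
  qed
  have BS: "B (inv B x) = x" for x using surj by (simp add: surj_f_inv_f)
  have SB: "inv B (B x) = x" for x using inj by simp
  have "bounded_clinear (inv B)"
  proof (rule bounded_clinearI[where K = "1 / c"])
    show "inv B (x + y) = inv B x + inv B y" for x y
      by (rule injD[OF inj]) (simp add: BS bounded_clinear_add[OF B])
    show "inv B (a *\<^sub>C x) = a *\<^sub>C inv B x" for a x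
      by (rule injD[OF inj]) (simp add: BS bounded_clinear_scaleC[OF B])
    show "norm (inv B x) \<le> norm x * (1 / c)" for x
      using c(2)[of "inv B x"] c(1) by (simp add: BS field_simps)
  qed
  then show ?thesis by (intro exI[of _ "inv B"]) (auto simp: BS SB)
qed

text \<open>At a real Fredholm point \<open>m\<close> the operator \<open>A - m\<close> vanishes on its null space and is bounded
  below on the orthogonal complement, and both subspaces are invariant. Moving \<open>m\<close> to a nearby
  \<open>\<mu>\<close> keeps a lower bound on the second and makes \<open>A - \<mu>\<close> a nonzero multiple of the identity on the
  first, so \<open>A - \<mu>\<close> is invertible.\<close>

lemma isolated_in_op_spectrum_if_fredholm:
  fixes A :: "'a::chilbert_space \<Rightarrow> 'a"
  assumes A: "self_adjoint A" and fred: "fredholm (shift_op A (complex_of_real m))"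
    and eig: "null_space (shift_op A (complex_of_real m)) \<noteq> {0}"
  shows "complex_of_real m isolated_in op_spectrum A"
proof -
  let ?m = "complex_of_real m" and ?N = "null_space (shift_op A (complex_of_real m))"
  note bA = self_adjoint_bounded_clinear[OF A]
  note b = bounded_clinear_shift_op[OF bA]
  obtain c where c: "c > 0" "\<And>x. x \<in> orth_compl ?N \<Longrightarrow> c * norm x \<le> norm (shift_op A ?m x)"
    using bounded_below_if_closed_range[OF b, of ?m] fred unfolding fredholm_def by blast
  \<comment> \<open>\<open>cmod (?m - \<mu>)\<close> bounds \<open>A - \<mu>\<close> from below on the null space of \<open>A - m\<close>, and
    \<open>c - cmod (?m - \<mu>)\<close> on its orthogonal complement.\<close>
  have below: "min (cmod (?m - \<mu>)) (c - cmod (?m - \<mu>)) * norm x \<le> norm (shift_op A \<mu> x)"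
    if \<mu>: "\<mu> \<noteq> ?m" "cmod (?m - \<mu>) < c" for \<mu> x
  proof -
    define k where "k = min (cmod (?m - \<mu>)) (c - cmod (?m - \<mu>))"
    have k: "0 < k" "k \<le> cmod (?m - \<mu>)" "k \<le> c - cmod (?m - \<mu>)"
      using \<mu> by (auto simp: k_def)
    obtain p where p: "p \<in> ?N" "x - p \<in> orth_compl ?N"
      using orthogonal_projection_exists[OF subspace_null_space[OF b] closed_null_space[OF b]] .
    define w where "w = x - p"
    have Ap: "A p = ?m *\<^sub>C p" using p(1) by (simp add: null_space_shift_op)
    have pw: "cinner p w = 0"
      using p by (simp add: w_def cinner_eq_0_commute orth_compl_def)
    have "cinner p (A w) = 0"
      by (simp add: self_adjoint_cinner[OF A, symmetric] Ap cinner_simps pw)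
    then have orth: "cinner ((?m - \<mu>) *\<^sub>C p) (shift_op A \<mu> w) = 0"
      by (simp add: shift_op_def cinner_simps pw)
    have "shift_op A \<mu> p = (?m - \<mu>) *\<^sub>C p"
      by (simp add: shift_op_def Ap complex_vector.scale_left_diff_distrib)
    then have "shift_op A \<mu> x = (?m - \<mu>) *\<^sub>C p + shift_op A \<mu> w"
      using bounded_clinear_add[OF b, of \<mu> p w] by (simp add: w_def)
    with pythagoras[OF orth]
    have split: "(norm (shift_op A \<mu> x))\<^sup>2 = (cmod (?m - \<mu>) * norm p)\<^sup>2 + (norm (shift_op A \<mu> w))\<^sup>2"
      by (simp add: norm_scaleC)
    have "k * norm w \<le> norm (shift_op A \<mu> w)"
    proof -
      have "shift_op A ?m w = shift_op A \<mu> w - (?m - \<mu>) *\<^sub>C w"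
        by (simp add: shift_op_def complex_vector.scale_left_diff_distrib)
      then have "norm (shift_op A ?m w) \<le> norm (shift_op A \<mu> w) + cmod (?m - \<mu>) * norm w"
        by (metis norm_scaleC norm_triangle_ineq4)
      moreover have "c * norm w \<le> norm (shift_op A ?m w)" using c(2) p(2) by (simp add: w_def)
      moreover have "k * norm w \<le> (c - cmod (?m - \<mu>)) * norm w"
        using k(3) by (rule mult_right_mono) simp
      ultimately show ?thesis by (simp add: left_diff_distrib)
    qed
    moreover have "k * norm p \<le> cmod (?m - \<mu>) * norm p"
      using k(2) by (rule mult_right_mono) simp
    ultimately have "(k * norm p)\<^sup>2 + (k * norm w)\<^sup>2 \<le> (norm (shift_op A \<mu> x))\<^sup>2"
      unfolding split using k(1) by (intro add_mono power_mono) auto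
    moreover have "(norm x)\<^sup>2 = (norm p)\<^sup>2 + (norm w)\<^sup>2"
      using pythagoras[OF pw] by (simp add: w_def)
    then have "(k * norm p)\<^sup>2 + (k * norm w)\<^sup>2 = (k * norm x)\<^sup>2"
      by (simp add: power_mult_distrib distrib_left)
    ultimately have "(k * norm x)\<^sup>2 \<le> (norm (shift_op A \<mu> x))\<^sup>2" by simp
    then have "k * norm x \<le> norm (shift_op A \<mu> x)" by (rule power2_le_imp_le) simp
    then show ?thesis by (simp add: k_def)
  qed
  have resolvent: "\<mu> \<notin> op_spectrum A" if \<mu>: "\<mu> \<noteq> ?m" "cmod (?m - \<mu>) < c" for \<mu>
  proof -
    define k where "k = min (cmod (?m - \<mu>)) (c - cmod (?m - \<mu>))"
    have k: "0 < k" using \<mu> by (simp add: k_def)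
    \<comment> \<open>A vector orthogonal to the range is annihilated by \<open>A - cnj \<mu>\<close>, and \<open>cnj \<mu>\<close> is as close to the
      real number \<open>m\<close> as \<open>\<mu>\<close>.\<close>
    have dense: "orth_compl (range (shift_op A \<mu>)) \<subseteq> {0}"
    proof
      fix y assume "y \<in> orth_compl (range (shift_op A \<mu>))"
      then have "y \<in> null_space (shift_op A (cnj \<mu>))"
        using null_space_cadjoint[OF b, of \<mu>] by (simp add: cadjoint_shift_op[OF A])
      moreover have "cmod (?m - cnj \<mu>) = cmod (?m - \<mu>)"
        by (metis complex_cnj_complex_of_real complex_cnj_diff complex_mod_cnj)
      moreover have "cnj \<mu> \<noteq> ?m" using \<mu>(1) by (metis complex_cnj_cnj complex_cnj_complex_of_real)
      ultimately have "k * norm y \<le> 0"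
        using below[of "cnj \<mu>" y] \<mu>(2) by (simp add: k_def null_space_def)
      then show "y \<in> {0}" using k by (simp add: mult_le_0_iff)
    qed
    have "\<exists>S. bounded_clinear S \<and> S \<circ> shift_op A \<mu> = id \<and> shift_op A \<mu> \<circ> S = id"
      by (rule invertible_if_bounded_below[OF b k _ dense]) (simp add: k_def below[OF \<mu>])
    then show ?thesis unfolding op_spectrum_def by blast
  qed
  have "?m \<in> op_spectrum A"
  proof -
    have "0 \<in> ?N" by (simp add: null_space_def bounded_clinear_zero[OF b])
    then obtain x where x: "x \<in> ?N" "x \<noteq> 0" using eig by blast
    have "False" if "bounded_clinear S" "S \<circ> shift_op A ?m = id" for S
    proof -
      have "x = S (shift_op A ?m x)" using that(2) by (metis comp_apply id_apply)
      also have "\<dots> = 0" using x(1) that(1) by (simp add: null_space_def bounded_clinear_zero)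
      finally show False using x(2) by simp
    qed
    then show ?thesis by (auto simp: op_spectrum_def)
  qed
  moreover have "\<forall>\<mu>\<in>op_spectrum A. dist ?m \<mu> < c \<longrightarrow> \<mu> = ?m"
    using resolvent by (auto simp: dist_norm)
  ultimately show ?thesis
    unfolding isolated_in_dist_Ex_iff using c(1) by blast
qed

text \<open>Let \<open>m\<close> be the norm of \<open>C\<close> on the invariant subspace \<open>W\<close>. Vectors that nearly attain it are
  nearly annihilated by \<open>C\<^sup>2 - m\<^sup>2 = (C - m) (C + m)\<close>, because
  \<open>norm (C\<^sup>2 x - m\<^sup>2 x)\<^sup>2 \<le> m\<^sup>2 (m\<^sup>2 (norm x)\<^sup>2 - (norm (C x))\<^sup>2)\<close>. If \<open>m > 0\<close> and both factors are bounded
  below on \<open>W\<close>, no such vectors exist.\<close>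

lemma self_adjoint_zero_if_shifts_bounded_below:
  fixes C :: "'a::chilbert_space \<Rightarrow> 'a"
  assumes C: "self_adjoint C" and W: "complex_vector.subspace W"
    and inv: "\<And>x. x \<in> W \<Longrightarrow> C x \<in> W"
    and below: "\<And>m. m \<noteq> 0 \<Longrightarrow> \<exists>c>0. \<forall>x\<in>W. c * norm x \<le> norm (C x - m *\<^sub>R x)"
    and x: "x \<in> W"
  shows "C x = 0"
proof -
  interpret C: bounded_linear C
    by (rule bounded_clinear_bounded_linear[OF self_adjoint_bounded_clinear[OF C]])
  define L where "L = {b. 0 \<le> b \<and> (\<forall>x\<in>W. norm (C x) \<le> b * norm x)}"
  define m where "m = Inf L"
  obtain K where "K \<ge> 0" "\<And>x. norm (C x) \<le> norm x * K" using C.nonneg_bounded by blast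
  then have ne: "L \<noteq> {}" by (auto simp: L_def mult.commute)
  have bdd: "bdd_below L" by (rule bdd_belowI[of _ 0]) (simp add: L_def)
  have m0: "0 \<le> m" unfolding m_def by (rule cInf_greatest[OF ne]) (simp add: L_def)
  have m: "norm (C x) \<le> m * norm x" if "x \<in> W" for x
  proof (cases "x = 0")
    case False
    have "norm (C x) / norm x \<le> m"
      unfolding m_def using False that
      by (intro cInf_greatest[OF ne]) (simp add: L_def field_simps)
    then show ?thesis using False by (simp add: field_simps)
  qed (simp add: C.zero)
  have "m = 0"
  proof (rule ccontr)
    assume "m \<noteq> 0"
    then have mpos: "m > 0" using m0 by simp
    obtain c where c: "c > 0" "\<And>x. x \<in> W \<Longrightarrow> c * norm x \<le> norm (C x - m *\<^sub>R x)"
      using below[of m] mpos by auto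
    obtain d where d: "d > 0" "\<And>x. x \<in> W \<Longrightarrow> d * norm x \<le> norm (C x - (- m) *\<^sub>R x)"
      using below[of "- m"] mpos by auto
    define k where "k = c * d"
    have k: "k > 0" using c(1) d(1) by (simp add: k_def)
    have le: "(norm (C x))\<^sup>2 \<le> (m\<^sup>2 - k\<^sup>2 / m\<^sup>2) * (norm x)\<^sup>2" if x: "x \<in> W" for x
    proof -
      let ?y = "C x + m *\<^sub>R x" and ?z = "C (C x) - m\<^sup>2 *\<^sub>R x"
      have y: "?y \<in> W"
        using W inv[OF x] x
        by (simp add: scaleR_scaleC complex_vector.subspace_add complex_vector.subspace_scale)
      have "C ?y - m *\<^sub>R ?y = ?z"
        by (simp add: C.add C.scaleR algebra_simps power2_eq_square)
      with c(2)[OF y] have "c * norm ?y \<le> norm ?z" by simp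
      moreover have "c * (d * norm x) \<le> c * norm ?y"
        using d(2)[OF x] c(1) by (intro mult_left_mono) auto
      ultimately have "k * norm x \<le> norm ?z" by (simp add: k_def mult.assoc)
      then have "(k * norm x)\<^sup>2 \<le> (norm ?z)\<^sup>2" using k by (intro power_mono) auto
      also have "\<dots> = (norm (C (C x)))\<^sup>2 - 2 * m\<^sup>2 * (norm (C x))\<^sup>2 + m ^ 4 * (norm x)\<^sup>2"
      proof -
        have "cinner (C (C x)) (m\<^sup>2 *\<^sub>R x) = complex_of_real (m\<^sup>2 * (norm (C x))\<^sup>2)"
          by (simp add: scaleR_scaleC cinner_simps self_adjoint_cinner[OF C, of "C x"] cinner_self)
        then show ?thesis
          by (simp add: power2_norm_diff power_mult_distrib)
      qed
      also have "\<dots> \<le> m\<^sup>2 * (norm (C x))\<^sup>2 - 2 * m\<^sup>2 * (norm (C x))\<^sup>2 + m ^ 4 * (norm x)\<^sup>2"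
      proof -
        have "(norm (C (C x)))\<^sup>2 \<le> (m * norm (C x))\<^sup>2"
          using m[OF inv[OF x]] by (intro power_mono) auto
        then show ?thesis by (simp add: power_mult_distrib)
      qed
      finally have "m\<^sup>2 * (norm (C x))\<^sup>2 \<le> m ^ 4 * (norm x)\<^sup>2 - k\<^sup>2 * (norm x)\<^sup>2"
        by (simp add: power_mult_distrib)
      also have "\<dots> = m\<^sup>2 * ((m\<^sup>2 - k\<^sup>2 / m\<^sup>2) * (norm x)\<^sup>2)"
        using mpos by (simp add: field_simps power4_eq_xxxx power2_eq_square)
      finally show ?thesis using mpos by simp
    qed
    \<comment> \<open>The estimate improves \<open>m\<close> to the strictly smaller bound \<open>q\<close>.\<close>
    define q where "q = sqrt (max 0 (m\<^sup>2 - k\<^sup>2 / m\<^sup>2))"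
    have "norm (C x) \<le> q * norm x" if "x \<in> W" for x
    proof (rule power2_le_imp_le)
      have "(norm (C x))\<^sup>2 \<le> max 0 (m\<^sup>2 - k\<^sup>2 / m\<^sup>2) * (norm x)\<^sup>2"
        using le[OF that] by (rule order_trans) (simp add: mult_right_mono)
      then show "(norm (C x))\<^sup>2 \<le> (q * norm x)\<^sup>2"
        by (simp add: q_def power_mult_distrib)
    qed (simp add: q_def)
    then have "q \<in> L" by (simp add: L_def q_def)
    then have "m \<le> q" unfolding m_def using bdd by (rule cInf_lower)
    then have "m\<^sup>2 \<le> q\<^sup>2" using m0 by (intro power_mono)
    also have "q\<^sup>2 = max 0 (m\<^sup>2 - k\<^sup>2 / m\<^sup>2)" by (simp add: q_def)
    also have "\<dots> < m\<^sup>2" using mpos k by simp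
    finally show False by simp
  qed
  with m[OF x] show ?thesis by simp
qed

section \<open>Self-adjoint operators whose essential spectrum is a point\<close>

lemma cdim_pos:
  assumes "finite_cdim N" "N \<noteq> {0}" "0 \<in> N"
  shows "cdim N > 0"
proof (rule ccontr)
  assume "\<not> cdim N > 0"
  obtain C where C: "finite C" "cspan C = N" using assms(1) by (auto simp: finite_cdim_def)
  obtain B where B: "B \<subseteq> N" "complex_vector.independent B" "N \<subseteq> cspan B" "card B = cdim N"
    using complex_vector.basis_exists by blast
  have "finite B" using complex_vector.independent_span_bound[OF C(1) B(2)] B(1) C(2) by simp
  then have "B = {}" using B(4) \<open>\<not> cdim N > 0\<close> by simp
  then show False using B(3) assms(2,3) by auto
qed

text \<open>The sum of the finitely many eigenspaces is finite-dimensional, and on its orthogonal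
  complement every \<open>A - (\<alpha> + m)\<close> with \<open>m \<noteq> 0\<close> is injective with closed range. So \<open>A - \<alpha>\<close>
  vanishes there.\<close>

lemma finite_rank_if_ess_spectrum_singleton:
  fixes A :: "'a::chilbert_space \<Rightarrow> 'a"
  assumes A: "self_adjoint A" and ess: "ess_spectrum A = {complex_of_real \<alpha>}"
    and fin: "finite {(\<mu>, i) \<in> discrete_eigenvalues_mult A. \<mu> \<noteq> complex_of_real \<alpha>}"
  shows "finite_rank (\<lambda>x. complex_of_real \<alpha> *\<^sub>C x - A x)"
proof -
  note bA = self_adjoint_bounded_clinear[OF A]
  note b = bounded_clinear_shift_op[OF bA]
  define N where "N \<mu> = null_space (shift_op A \<mu>)" for \<mu>
  define D where "D = {\<mu> \<in> discrete_eigenvalues A. \<mu> \<noteq> complex_of_real \<alpha>}"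
  have "D \<subseteq> fst ` {(\<mu>, i) \<in> discrete_eigenvalues_mult A. \<mu> \<noteq> complex_of_real \<alpha>}"
  proof
    fix \<mu> assume \<mu>: "\<mu> \<in> D"
    have "cdim (null_space (shift_op A \<mu>)) > 0"
      using \<mu> bounded_clinear_zero[OF b]
      by (intro cdim_pos) (auto simp: D_def discrete_eigenvalues_def null_space_def)
    then have "(\<mu>, 0) \<in> {(\<mu>, i) \<in> discrete_eigenvalues_mult A. \<mu> \<noteq> complex_of_real \<alpha>}"
      using \<mu> by (simp add: D_def discrete_eigenvalues_mult_def)
    then show "\<mu> \<in> fst ` {(\<mu>, i) \<in> discrete_eigenvalues_mult A. \<mu> \<noteq> complex_of_real \<alpha>}"
      by (metis (no_types, lifting) fst_conv image_eqI)
  qed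
  then have finD: "finite D" using fin finite_surj by blast
  have "\<exists>B. finite B \<and> cspan B = N \<mu>" if "\<mu> \<in> D" for \<mu>
    using that by (auto simp: D_def discrete_eigenvalues_def finite_cdim_def N_def)
  then obtain f where f: "\<And>\<mu>. \<mu> \<in> D \<Longrightarrow> finite (f \<mu>)" "\<And>\<mu>. \<mu> \<in> D \<Longrightarrow> cspan (f \<mu>) = N \<mu>"
    by metis
  define B where "B = (\<Union>\<mu>\<in>D. f \<mu>)"
  have finB: "finite B" using finD f(1) by (simp add: B_def)
  define C where "C = shift_op A (complex_of_real \<alpha>)"
  have bC: "bounded_clinear C" unfolding C_def by (rule b)
  have saC: "self_adjoint C"
    using bC cinner_shift_op[OF A, of "complex_of_real \<alpha>"] by (auto intro!: self_adjointI simp: C_def)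
  have WN: "x \<in> orth_compl (N \<mu>)" if "x \<in> orth_compl B" "\<mu> \<in> D" for x \<mu>
  proof -
    have "x \<in> orth_compl (f \<mu>)" using that by (auto simp: orth_compl_def B_def)
    then show ?thesis using orth_compl_span[of "f \<mu>"] f(2)[OF that(2)] by simp
  qed
  have "C x = 0" if x: "x \<in> orth_compl B" for x
  proof (rule self_adjoint_zero_if_shifts_bounded_below[OF saC subspace_orth_compl _ _ x])
    fix x assume x: "x \<in> orth_compl B"
    have "cinner (C x) y = 0" if "y \<in> f \<mu>" "\<mu> \<in> D" for y \<mu>
    proof -
      have y: "y \<in> N \<mu>" using that f(2) complex_vector.span_base by blast
      then have "A y = \<mu> *\<^sub>C y" by (simp add: N_def null_space_shift_op)
      then have "C y = (\<mu> - complex_of_real \<alpha>) *\<^sub>C y"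
        by (simp add: C_def shift_op_def complex_vector.scale_left_diff_distrib)
      moreover have "cinner x y = 0" using WN[OF x that(2)] y by (simp add: orth_compl_def)
      ultimately show ?thesis
        by (simp add: self_adjoint_cinner[OF saC] cinner_scaleC_right)
    qed
    then show "C x \<in> orth_compl B" by (auto simp: orth_compl_def B_def)
  next
    fix m :: real assume m: "m \<noteq> 0"
    let ?\<mu> = "complex_of_real (\<alpha> + m)"
    have "?\<mu> \<notin> ess_spectrum A" using m unfolding ess by (simp del: of_real_add)
    then have fred: "fredholm (shift_op A ?\<mu>)" by (simp add: ess_spectrum_def)
    obtain c where c: "c > 0" "\<And>x. x \<in> orth_compl (N ?\<mu>) \<Longrightarrow> c * norm x \<le> norm (shift_op A ?\<mu> x)"
      using bounded_below_if_closed_range[OF b, of ?\<mu>] fred unfolding fredholm_def N_def by blast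
    have sub: "x \<in> orth_compl (N ?\<mu>)" if "x \<in> orth_compl B" for x
    proof (cases "N ?\<mu> = {0}")
      case True
      then show ?thesis by (simp add: orth_compl_def)
    next
      case False
      then have "?\<mu> isolated_in op_spectrum A"
        using isolated_in_op_spectrum_if_fredholm[OF A fred] unfolding N_def by blast
      then have "?\<mu> \<in> discrete_eigenvalues A"
        using False fred by (simp add: discrete_eigenvalues_def N_def fredholm_def del: of_real_add)
      then have "?\<mu> \<in> D" using m by (simp add: D_def)
      with that show ?thesis by (rule WN)
    qed
    have "shift_op A ?\<mu> x = C x - m *\<^sub>R x" for x
      by (simp add: C_def shift_op_def scaleR_scaleC complex_vector.scale_left_distrib)
    then have "\<forall>x\<in>orth_compl B. c * norm x \<le> norm (C x - m *\<^sub>R x)"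
      using c(2) sub by metis
    with c(1) show "\<exists>c>0. \<forall>x\<in>orth_compl B. c * norm x \<le> norm (C x - m *\<^sub>R x)" by blast
  qed
  then have "finite_rank C"
    by (intro finite_rank_if_orth_compl_maps_to_span[OF bC finB, of "{}"]) simp_all
  from finite_rank_scale[OF this, of "-1"] show ?thesis
    by (simp add: C_def shift_op_def complex_vector.scale_minus_left)
qed

text \<open>On the null space of the finite-rank operator \<open>a - A\<close>, which has finite codimension,
  \<open>A - \<mu>\<close> is multiplication by \<open>a - \<mu>\<close>, so the range of \<open>A - \<mu>\<close> contains that null space.\<close>

lemma closed_range_shift_op:
  fixes A :: "'a::chilbert_space \<Rightarrow> 'a"
  assumes A: "bounded_clinear A" and K: "finite_rank (\<lambda>x. a *\<^sub>C x - A x)" and \<mu>: "\<mu> \<noteq> a"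
  shows "closed (range (shift_op A \<mu>))"
proof -
  obtain B where B: "finite B" "orth_compl B = null_space (\<lambda>x. a *\<^sub>C x - A x)"
    using finite_rank_null_space[OF K] .
  show ?thesis
  proof (rule closed_subspace_finite_codim[OF subspace_range[OF bounded_clinear_shift_op[OF A]] B(1)])
    show "orth_compl B \<subseteq> range (shift_op A \<mu>)"
    proof
      fix x assume "x \<in> orth_compl B"
      then have "A x = a *\<^sub>C x" using B(2) by (simp add: null_space_def)
      then have "shift_op A \<mu> x = (a - \<mu>) *\<^sub>C x"
        by (simp add: shift_op_def complex_vector.scale_left_diff_distrib)
      then have "shift_op A \<mu> (inverse (a - \<mu>) *\<^sub>C x) = inverse (a - \<mu>) *\<^sub>C (a - \<mu>) *\<^sub>C x"
        by (simp only: bounded_clinear_scaleC[OF bounded_clinear_shift_op[OF A]])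
      also have "\<dots> = x" using \<mu> by (simp add: scaleC_scaleC)
      finally show "x \<in> range (shift_op A \<mu>)" by (metis rangeI)
    qed
  qed
qed

text \<open>On an eigenvector for \<open>\<mu>\<close> the operator \<open>a - A\<close> is multiplication by \<open>a - \<mu>\<close>.\<close>

lemma eigenspace_subset_range:
  assumes K: "bounded_clinear (\<lambda>x. a *\<^sub>C x - A x)" and \<mu>: "\<mu> \<noteq> a"
  shows "null_space (shift_op A \<mu>) \<subseteq> range (\<lambda>x. a *\<^sub>C x - A x)"
proof
  fix x assume "x \<in> null_space (shift_op A \<mu>)"
  then have "a *\<^sub>C x - A x = (a - \<mu>) *\<^sub>C x"
    by (simp add: null_space_shift_op complex_vector.scale_left_diff_distrib)
  then have "inverse (a - \<mu>) *\<^sub>C (a *\<^sub>C x - A x) = x"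
    using \<mu> by (simp add: scaleC_scaleC)
  moreover have "inverse (a - \<mu>) *\<^sub>C (a *\<^sub>C x - A x) \<in> range (\<lambda>x. a *\<^sub>C x - A x)"
    by (intro complex_vector.subspace_scale[OF subspace_range[OF K]] rangeI)
  ultimately show "x \<in> range (\<lambda>x. a *\<^sub>C x - A x)" by simp
qed

lemma independent_if_orthogonal:
  assumes "\<And>a. a \<in> E \<Longrightarrow> a \<noteq> 0" "\<And>a b. a \<in> E \<Longrightarrow> b \<in> E \<Longrightarrow> a \<noteq> b \<Longrightarrow> cinner a b = 0"
  shows "complex_vector.independent E"
proof
  assume "complex_vector.dependent E"
  then obtain a where a: "a \<in> E" "a \<in> cspan (E - {a})"
    by (auto simp: complex_vector.dependent_def)
  have "a \<in> orth_compl (E - {a})" using assms(2) a(1) by (auto simp: orth_compl_def)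
  from cinner_eq_0_spanI(1)[OF this a(2)] show False using assms(1)[OF a(1)] by simp
qed

lemma eigenvectors_orthogonal:
  fixes A :: "'a::chilbert_space \<Rightarrow> 'a"
  assumes A: "self_adjoint A" and x: "A x = \<mu> *\<^sub>C x" and y: "A y = \<nu> *\<^sub>C y" "y \<noteq> 0"
    and ne: "\<mu> \<noteq> \<nu>"
  shows "cinner x y = 0"
proof -
  have "\<nu> * cinner y y = cnj \<nu> * cinner y y"
    using self_adjoint_cinner[OF A, of y y] by (simp add: y cinner_simps)
  then have real: "cnj \<nu> = \<nu>" using y(2) by simp
  have "\<mu> * cinner x y = cnj \<nu> * cinner x y"
    using self_adjoint_cinner[OF A, of x y] by (simp add: x y cinner_simps)
  then show ?thesis using real ne by simp
qed

text \<open>Choosing one eigenvector for each eigenvalue gives an orthogonal, hence independent, family.\<close>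

lemma finite_eigenvalues_if_eigenvectors_in_span:
  fixes A :: "'a::chilbert_space \<Rightarrow> 'a"
  assumes A: "self_adjoint A" and C: "finite C"
    and D: "\<And>\<mu>. \<mu> \<in> D \<Longrightarrow> null_space (shift_op A \<mu>) \<noteq> {0}"
    "\<And>\<mu>. \<mu> \<in> D \<Longrightarrow> null_space (shift_op A \<mu>) \<subseteq> cspan C"
  shows "finite D"
proof -
  have "\<exists>x. x \<noteq> 0 \<and> x \<in> null_space (shift_op A \<mu>)" if "\<mu> \<in> D" for \<mu>
    using D(1)[OF that]
      complex_vector.subspace_0[OF subspace_null_space[OF
          bounded_clinear_shift_op[OF self_adjoint_bounded_clinear[OF A]]], of \<mu>]
    by blast
  then obtain e where e: "\<And>\<mu>. \<mu> \<in> D \<Longrightarrow> e \<mu> \<noteq> 0"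
    "\<And>\<mu>. \<mu> \<in> D \<Longrightarrow> e \<mu> \<in> null_space (shift_op A \<mu>)" by metis
  have orth: "cinner (e \<mu>) (e \<nu>) = 0" if "\<mu> \<in> D" "\<nu> \<in> D" "\<mu> \<noteq> \<nu>" for \<mu> \<nu>
    using eigenvectors_orthogonal[OF A] e that by (simp add: null_space_shift_op)
  have inj: "inj_on e D"
  proof (rule inj_onI, rule ccontr)
    fix \<mu> \<nu> assume "\<mu> \<in> D" "\<nu> \<in> D" "e \<mu> = e \<nu>" "\<mu> \<noteq> \<nu>"
    then show False using orth[of \<mu> \<nu>] e(1)[of \<nu>] by simp
  qed
  have "complex_vector.independent (e ` D)"
  proof (rule independent_if_orthogonal)
    show "a \<noteq> 0" if "a \<in> e ` D" for a using that e(1) by auto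
    show "cinner a b = 0" if "a \<in> e ` D" "b \<in> e ` D" "a \<noteq> b" for a b
    proof -
      obtain \<mu> \<nu> where "\<mu> \<in> D" "a = e \<mu>" "\<nu> \<in> D" "b = e \<nu>" using \<open>a \<in> e ` D\<close> \<open>b \<in> e ` D\<close> by blast
      then show ?thesis using orth[of \<mu> \<nu>] that(3) by auto
    qed
  qed
  moreover have "e ` D \<subseteq> cspan C" using e(2) D(2) by auto
  ultimately have "finite (e ` D)"
    using complex_vector.independent_span_bound[OF C] by blast
  then show ?thesis using inj by (rule finite_imageD)
qed

text \<open>Away from \<open>\<alpha>\<close> all eigenvectors lie in the finite-dimensional range of \<open>\<alpha> - A\<close>; this bounds the
  null spaces and the number of eigenvalues. At \<open>\<alpha>\<close> the null space has finite codimension, so it is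
  infinite-dimensional.\<close>

lemma ess_spectrum_singleton_if_finite_rank:
  fixes A :: "'a::chilbert_space \<Rightarrow> 'a"
  assumes inf: "\<not> finite_cdim (UNIV :: 'a set)" and A: "self_adjoint A"
    and K: "finite_rank (\<lambda>x. complex_of_real \<alpha> *\<^sub>C x - A x)"
  shows "ess_spectrum A = {complex_of_real \<alpha>}"
    and "finite {(\<mu>, i) \<in> discrete_eigenvalues_mult A. \<mu> \<noteq> complex_of_real \<alpha>}"
proof -
  let ?a = "complex_of_real \<alpha>" and ?K = "\<lambda>x. complex_of_real \<alpha> *\<^sub>C x - A x"
  note bA = self_adjoint_bounded_clinear[OF A]
  note b = bounded_clinear_shift_op[OF bA]
  obtain C where C: "bounded_clinear ?K" "finite C" "range ?K = cspan C"
    using finite_rankE[OF K] by blast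
  have null: "null_space (shift_op A \<mu>) \<subseteq> cspan C" if "\<mu> \<noteq> ?a" for \<mu>
    using eigenspace_subset_range[OF C(1) that] C(3) by simp
  have fin_null: "finite_cdim (null_space (shift_op A \<mu>))" if "\<mu> \<noteq> ?a" for \<mu>
    by (rule finite_cdim_mono[OF finite_cdim_span[OF C(2)] subspace_null_space[OF b] null[OF that]])
  have "fredholm (shift_op A \<mu>)" if \<mu>: "\<mu> \<noteq> ?a" for \<mu>
  proof -
    have "cnj \<mu> \<noteq> ?a" using \<mu> by (metis complex_cnj_cnj complex_cnj_complex_of_real)
    then show ?thesis
      using b closed_range_shift_op[OF bA K \<mu>] fin_null \<mu>
      by (simp add: fredholm_def cadjoint_shift_op[OF A])
  qed
  moreover have "\<not> fredholm (shift_op A ?a)"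
  proof
    assume "fredholm (shift_op A ?a)"
    then obtain E where E: "finite E" "cspan E = null_space (shift_op A ?a)"
      by (auto simp: fredholm_def finite_cdim_def)
    obtain B where B: "finite B" "orth_compl B = null_space ?K"
      using finite_rank_null_space[OF K] .
    have "x \<in> cspan (B \<union> E)" for x
    proof -
      obtain p where p: "p \<in> cspan B" "x - p \<in> orth_compl B"
        using orthogonal_decomposition_span[OF B(1)] .
      have "x - p \<in> cspan E"
        using p(2) unfolding B(2) E(2) by (simp add: null_space_def shift_op_def)
      then have "p + (x - p) \<in> cspan (B \<union> E)"
        using p(1) complex_vector.span_mono[of B "B \<union> E"] complex_vector.span_mono[of E "B \<union> E"]
        by (intro complex_vector.span_add) auto
      then show ?thesis by simp
    qed
    then have "cspan (B \<union> E) = UNIV" by blast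
    then show False using inf B(1) E(1) finite_cdim_span[of "B \<union> E"] by simp
  qed
  ultimately show "ess_spectrum A = {?a}" by (auto simp: ess_spectrum_def)
  define D where "D = {\<mu> \<in> discrete_eigenvalues A. \<mu> \<noteq> ?a}"
  have "finite D"
    using null by (intro finite_eigenvalues_if_eigenvectors_in_span[OF A C(2)])
      (auto simp: D_def discrete_eigenvalues_def)
  then have "finite (SIGMA \<mu>:D. {..<cdim (null_space (shift_op A \<mu>))})" by simp
  moreover have "{(\<mu>, i) \<in> discrete_eigenvalues_mult A. \<mu> \<noteq> ?a}
      = (SIGMA \<mu>:D. {..<cdim (null_space (shift_op A \<mu>))})"
    by (auto simp: discrete_eigenvalues_mult_def D_def)
  ultimately show "finite {(\<mu>, i) \<in> discrete_eigenvalues_mult A. \<mu> \<noteq> ?a}" by simp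
qed

section \<open>Operators that scale lengths on a subspace of finite codimension\<close>

text \<open>The quadratic form of \<open>K = \<alpha> - T\<^sup>* T\<close> at \<open>x\<close> is \<open>\<alpha> (norm x)\<^sup>2 - (norm (T x))\<^sup>2\<close>, so it vanishes on
  the null space of \<open>K\<close>. Conversely, if it vanishes on \<open>W = orth_compl B\<close>, then by polarization \<open>K\<close> maps \<open>W\<close> into the orthogonal complement of \<open>W\<close>,
  which is the span of \<open>B\<close>.\<close>

lemma finite_rank_iff_scales_on_orth_compl:
  fixes T :: "'a::chilbert_space \<Rightarrow> 'a"
  assumes T: "bounded_clinear T"
  shows "finite_rank (\<lambda>x. complex_of_real \<alpha> *\<^sub>C x - cadjoint T (T x)) \<longleftrightarrow>
    (\<exists>B. finite B \<and> (\<forall>x\<in>orth_compl B. (norm (T x))\<^sup>2 = \<alpha> * (norm x)\<^sup>2))"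
    (is "finite_rank ?K \<longleftrightarrow> ?R")
proof
  have form: "cinner (?K x) x = complex_of_real (\<alpha> * (norm x)\<^sup>2 - (norm (T x))\<^sup>2)" for x
    by (simp add: cinner_simps cinner_cadjoint'[OF T] cinner_self)
  {
    assume "finite_rank ?K"
    then obtain B where B: "finite B" "orth_compl B = null_space ?K"
      by (rule finite_rank_null_space)
    have "(norm (T x))\<^sup>2 = \<alpha> * (norm x)\<^sup>2" if "x \<in> orth_compl B" for x
    proof -
      have "?K x = 0" using that B(2) by (simp add: null_space_def)
      then have "complex_of_real (\<alpha> * (norm x)\<^sup>2 - (norm (T x))\<^sup>2) = 0"
        using form[of x] by simp
      then show ?thesis by (simp only: of_real_eq_0_iff)
    qed
    with B(1) show ?R by blast
  next
    assume ?R
    then obtain B where B: "finite B" "\<And>x. x \<in> orth_compl B \<Longrightarrow> (norm (T x))\<^sup>2 = \<alpha> * (norm x)\<^sup>2"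
      by blast
    have bK: "bounded_clinear ?K"
      using bounded_clinear_comp[OF bounded_clinear_cadjoint[OF T] T]
      by (intro bounded_clinear_minus bounded_clinear_scale bounded_clinear_id) (simp add: o_def)
    have sym: "cinner (?K x) y = cinner x (?K y)" for x y
      by (simp add: cinner_simps cinner_cadjoint'[OF T] cinner_cadjoint[OF T])
    have zero: "cinner (?K x) x = 0" if "x \<in> orth_compl B" for x
      unfolding form using B(2)[OF that] by simp
    have Re0: "Re (cinner (?K x) y) = 0" if x: "x \<in> orth_compl B" and y: "y \<in> orth_compl B" for x y
    proof -
      have "x + y \<in> orth_compl B" using x y subspace_orth_compl complex_vector.subspace_add by metis
      then have "cinner (?K (x + y)) (x + y) = 0" by (rule zero)
      then have "cinner (?K x) y + cinner (?K y) x = 0"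
        using zero[OF x] zero[OF y]
        by (simp only: bounded_clinear_add[OF bK] cinner_add_left cinner_add_right add_0_left
            add_0_right add.commute)
      moreover have "Re (cinner (?K y) x) = Re (cinner (?K x) y)"
        by (simp only: sym[of y x] Re_cinner_commute[of y])
      ultimately show ?thesis by (simp add: complex_eq_iff)
    qed
    have "?K x \<in> cspan B" if x: "x \<in> orth_compl B" for x
    proof -
      have "cinner (?K x) y = 0" if y: "y \<in> orth_compl B" for y
      proof (rule complex_eqI)
        \<comment> \<open>Rotating \<open>y\<close> turns the imaginary part into a real part.\<close>
        have "\<i> *\<^sub>C y \<in> orth_compl B" using y subspace_orth_compl complex_vector.subspace_scale by metis
        from Re0[OF x this] show "Im (cinner (?K x) y) = Im 0"
          by (simp only: cinner_scaleC_right) simp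
      qed (use Re0[OF x y] in simp)
      then have "?K x \<in> orth_compl (orth_compl B)" by (simp add: orth_compl_def[of "orth_compl B"])
      then show ?thesis by (simp only: orth_compl_orth_compl_finite[OF B(1)])
    qed
    then show "finite_rank ?K"
      by (rule finite_rank_if_orth_compl_maps_to_span[OF bK B(1) B(1)])
  }
qed

text \<open>The decomposition along the span of \<open>B\<close> is unique, which makes it linear, and orthogonal, which
  makes it bounded.\<close>

lemma finite_rank_projection:
  fixes B :: "'a::complex_inner set"
  assumes B: "finite B"
  obtains P where "bounded_clinear P" "\<And>x. P x \<in> cspan B" "\<And>x. x - P x \<in> orth_compl B"
proof -
  have "\<exists>p. p \<in> cspan B \<and> x - p \<in> orth_compl B" for x
    using orthogonal_decomposition_span[OF B] by blast
  then obtain P where P: "\<And>x. P x \<in> cspan B" "\<And>x. x - P x \<in> orth_compl B" by metis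
  have uniq: "P x = p" if "p \<in> cspan B" "x - p \<in> orth_compl B" for x p
  proof -
    have "P x - p \<in> cspan B" using P(1) that(1) by (rule complex_vector.span_diff)
    moreover have "(x - p) - (x - P x) \<in> orth_compl B"
      using subspace_orth_compl that(2) P(2) by (rule complex_vector.subspace_diff)
    ultimately have "cinner (P x - p) (P x - p) = 0" by (intro cinner_eq_0_spanI) simp_all
    then show ?thesis by simp
  qed
  have "bounded_clinear P"
  proof (rule bounded_clinearI[where K = 1])
    show "P (x + y) = P x + P y" for x y
    proof (rule uniq)
      show "P x + P y \<in> cspan B" using P(1) by (intro complex_vector.span_add)
      have "(x - P x) + (y - P y) \<in> orth_compl B"
        using subspace_orth_compl P(2) P(2) by (rule complex_vector.subspace_add)
      then show "x + y - (P x + P y) \<in> orth_compl B" by (simp add: algebra_simps)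
    qed
    show "P (c *\<^sub>C x) = c *\<^sub>C P x" for c x
    proof (rule uniq)
      show "c *\<^sub>C P x \<in> cspan B" using P(1) by (rule complex_vector.span_scale)
      have "c *\<^sub>C (x - P x) \<in> orth_compl B"
        using subspace_orth_compl P(2) by (rule complex_vector.subspace_scale)
      then show "c *\<^sub>C x - c *\<^sub>C P x \<in> orth_compl B"
        by (simp add: complex_vector.scale_right_diff_distrib)
    qed
    show "norm (P x) \<le> norm x * 1" for x
    proof -
      have "cinner (P x) (x - P x) = 0" using P(2,1) by (rule cinner_eq_0_spanI)
      from norm_le_norm_add_orthogonal[OF this] show ?thesis by simp
    qed
  qed
  then show thesis using P that by blast
qed

text \<open>The partial isometry is \<open>T / sqrt \<alpha>\<close>, cut off to the subspace on which \<open>T\<close> scales lengths.\<close>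

lemma scales_on_orth_compl_iff_partial_isometry:
  fixes T :: "'a::chilbert_space \<Rightarrow> 'a"
  assumes T: "bounded_clinear T" and \<alpha>: "\<alpha> > 0"
  shows "(\<exists>B. finite B \<and> (\<forall>x\<in>orth_compl B. (norm (T x))\<^sup>2 = \<alpha> * (norm x)\<^sup>2)) \<longleftrightarrow>
    (\<exists>F V. finite_rank F \<and> partial_isometry V \<and> finite_cdim (null_space V) \<and>
      T = (\<lambda>x. F x + complex_of_real (sqrt \<alpha>) *\<^sub>C V x))"
    (is "?L \<longleftrightarrow> ?R")
proof
  assume ?R
  then obtain F V where F: "finite_rank F" and V: "partial_isometry V" "finite_cdim (null_space V)"
    and T_eq: "T = (\<lambda>x. F x + complex_of_real (sqrt \<alpha>) *\<^sub>C V x)" by blast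
  obtain B1 where B1: "finite B1" "cspan B1 = null_space V"
    using V(2) by (auto simp: finite_cdim_def)
  obtain B2 where B2: "finite B2" "orth_compl B2 = null_space F"
    using finite_rank_null_space[OF F] .
  have "(norm (T x))\<^sup>2 = \<alpha> * (norm x)\<^sup>2" if x: "x \<in> orth_compl (B1 \<union> B2)" for x
  proof -
    have "x \<in> orth_compl B2" and x1: "x \<in> orth_compl B1" using x by (auto simp: orth_compl_def)
    then have "F x = 0" using B2(2) by (simp add: null_space_def)
    moreover have "x \<in> orth_compl (null_space V)"
      using x1 orth_compl_span[of B1] B1(2) by simp
    then have "norm (V x) = norm x"
      using V(1) by (simp add: partial_isometry_def orth_compl_def)
    ultimately show ?thesis
      using \<alpha> by (simp add: T_eq norm_scaleC power_mult_distrib)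
  qed
  then show ?L using B1(1) B2(1) by (intro exI[of _ "B1 \<union> B2"]) simp
next
  assume ?L
  then obtain B where B: "finite B" "\<And>x. x \<in> orth_compl B \<Longrightarrow> (norm (T x))\<^sup>2 = \<alpha> * (norm x)\<^sup>2"
    by blast
  obtain P where P: "bounded_clinear P" "\<And>x. P x \<in> cspan B" "\<And>x. x - P x \<in> orth_compl B"
    using finite_rank_projection[OF B(1)] by blast
  have P0: "P x = 0" if "x \<in> orth_compl B" for x
  proof -
    have "x - (x - P x) \<in> orth_compl B"
      using subspace_orth_compl that P(3) by (rule complex_vector.subspace_diff)
    then have "cinner (P x) (P x) = 0" using P(2) by (intro cinner_eq_0_spanI) simp_all
    then show ?thesis by simp
  qed
  define r where "r = complex_of_real (sqrt \<alpha>)"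
  have r0: "r \<noteq> 0" using \<alpha> by (simp add: r_def)
  have norm_r: "cmod r = sqrt \<alpha>" using \<alpha> by (simp add: r_def)
  define V where "V x = inverse r *\<^sub>C T (x - P x)" for x
  have normV: "norm (V x) = norm (x - P x)" for x
  proof (rule power2_eq_imp_eq)
    show "(norm (V x))\<^sup>2 = (norm (x - P x))\<^sup>2"
      using \<alpha> B(2)[OF P(3), of x]
      by (simp add: V_def norm_scaleC norm_inverse norm_r power_mult_distrib power_inverse)
  qed simp_all
  have bV: "bounded_clinear V"
    unfolding V_def
    using bounded_clinear_scale[OF bounded_clinear_comp[OF T
          bounded_clinear_minus[OF bounded_clinear_id P(1)]], of "inverse r"]
    by (simp add: o_def)
  have nullV: "null_space V = cspan B"
  proof
    show "null_space V \<subseteq> cspan B"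
    proof
      fix x assume "x \<in> null_space V"
      then have "norm (x - P x) = 0" using normV[of x] by (simp add: null_space_def)
      then show "x \<in> cspan B" using P(2)[of x] by simp
    qed
    show "cspan B \<subseteq> null_space V"
    proof
      fix x assume x: "x \<in> cspan B"
      have "cinner (x - P x) (x - P x) = 0"
        using P(3) complex_vector.span_diff[OF x P(2)] by (rule cinner_eq_0_spanI)
      then have "norm (V x) = 0" using normV[of x] by simp
      then show "x \<in> null_space V" by (simp add: null_space_def)
    qed
  qed
  have "partial_isometry V"
    unfolding partial_isometry_def
  proof (intro conjI allI impI bV)
    fix x assume "\<forall>y\<in>null_space V. cinner x y = 0"
    then have "x \<in> orth_compl (cspan B)" by (simp add: nullV orth_compl_def)
    then have "x \<in> orth_compl B" by (simp only: orth_compl_span)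
    then show "norm (V x) = norm x" by (simp add: normV P0)
  qed
  moreover have "finite_rank (T \<circ> P)"
    by (rule finite_rank_if_orth_compl_maps_to_span[OF bounded_clinear_comp[OF T P(1)] B(1), of "{}"])
      (simp_all add: P0 bounded_clinear_zero[OF T])
  moreover have "T = (\<lambda>x. (T \<circ> P) x + r *\<^sub>C V x)"
    using r0 by (simp add: V_def scaleC_scaleC bounded_clinear_diff[OF T])
  moreover have "finite_cdim (null_space V)"
    unfolding nullV by (rule finite_cdim_span[OF B(1)])
  ultimately show ?R unfolding r_def by blast
qed

section \<open>The Moore--Penrose inverse and the adjoint\<close>

text \<open>The adjoint is injective on the closure of \<open>range T\<close>, so a limit of vectors \<open>T x\<^sub>n\<close> is
  recovered from its image in the closed range of \<open>T\<^sup>* T\<close>.\<close>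

lemma closed_range_if_closed_range_cadjoint_comp:
  fixes T :: "'a::chilbert_space \<Rightarrow> 'a"
  assumes T: "bounded_clinear T" and cl: "closed (range (cadjoint T \<circ> T))"
  shows "closed (range T)"
proof -
  note bT' = bounded_clinear_cadjoint[OF T]
  have "closure (range T) \<subseteq> range T"
  proof
    fix y assume y: "y \<in> closure (range T)"
    have "closed (cadjoint T -` range (cadjoint T \<circ> T))"
      by (rule closed_vimage[OF cl linear_continuous_on[OF bounded_clinear_bounded_linear[OF bT']]])
    then have "closure (range T) \<subseteq> cadjoint T -` range (cadjoint T \<circ> T)"
      by (intro closure_minimal) auto
    with y obtain x where x: "cadjoint T y = cadjoint T (T x)" by auto
    have null: "y - T x \<in> orth_compl (range T)"
      unfolding null_space_cadjoint[OF T, symmetric]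
      by (simp add: null_space_def bounded_clinear_diff[OF bT'] x)
    have "closure (range T) \<subseteq> orth_compl (orth_compl (range T))"
      by (intro closure_minimal closed_orth_compl subset_orth_compl_orth_compl)
    then have "y \<in> orth_compl (orth_compl (range T))" using y by blast
    then have "cinner y (y - T x) = 0" using null by (simp add: orth_compl_def[of "orth_compl (range T)"])
    moreover have "cinner (y - T x) (T x) = 0" using null by (simp add: orth_compl_def)
    then have "cinner (T x) (y - T x) = 0" by (simp only: cinner_eq_0_commute)
    ultimately have "cinner (y - T x) (y - T x) = 0" by (simp add: cinner_diff_left)
    then show "y \<in> range T" by simp
  qed
  then show ?thesis by (rule closure_subset_eq[THEN iffD1])
qed

text \<open>\<open>T\<^sup>\<dagger> T\<close> is the identity up to finite rank, since the null space of \<open>T\<close> is finite-dimensional.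
  Hence \<open>\<alpha> T\<^sup>\<dagger> - T\<^sup>*\<close>, multiplied by \<open>T\<close> from the right, is \<open>\<alpha> - T\<^sup>* T\<close> up to finite rank, and it is
  recovered by multiplying with \<open>T\<^sup>\<dagger>\<close> because it vanishes on the orthogonal complement of the range of
  \<open>T\<close>.\<close>

lemma finite_rank_iff_mp_inverse:
  fixes T :: "'a::chilbert_space \<Rightarrow> 'a"
  assumes T: "bounded_clinear T" and \<alpha>: "\<alpha> > 0"
  shows "finite_rank (\<lambda>x. complex_of_real \<alpha> *\<^sub>C x - cadjoint T (T x)) \<longleftrightarrow>
    closed (range T) \<and> finite_cdim (null_space T) \<and>
    finite_rank (\<lambda>x. complex_of_real \<alpha> *\<^sub>C mp_inverse T x - cadjoint T x)"
    (is "finite_rank ?K \<longleftrightarrow> _ \<and> _ \<and> finite_rank ?G")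
proof -
  let ?S = "mp_inverse T" and ?a = "complex_of_real \<alpha>"
  note bT' = bounded_clinear_cadjoint[OF T]
  have Q: "finite_rank (\<lambda>x. x - ?S (T x))" if cl: "closed (range T)" and fin: "finite_cdim (null_space T)"
  proof -
    have bS: "bounded_clinear ?S" and TST: "T \<circ> ?S \<circ> T = T"
      using mp_inverse_properties[OF T cl] by blast+
    have b: "bounded_clinear (\<lambda>x. x - ?S (T x))"
      using bounded_clinear_minus[OF bounded_clinear_id bounded_clinear_comp[OF bS T]]
      by (simp add: o_def)
    have "range (\<lambda>x. x - ?S (T x)) \<subseteq> null_space T"
      using fun_cong[OF TST] by (auto simp: null_space_def bounded_clinear_diff[OF T])
    then show ?thesis
      unfolding finite_rank_def using b finite_cdim_mono[OF fin subspace_range[OF b]] by blast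
  qed
  show ?thesis
  proof (intro iffI conjI)
    assume K: "finite_rank ?K"
    have A: "bounded_clinear (cadjoint T \<circ> T)" by (rule bounded_clinear_comp[OF bT' T])
    have K': "finite_rank (\<lambda>x. ?a *\<^sub>C x - (cadjoint T \<circ> T) x)" using K by simp
    have shift0: "shift_op (cadjoint T \<circ> T) 0 = cadjoint T \<circ> T"
      by (auto simp: shift_op_def)
    have a0: "0 \<noteq> ?a" using \<alpha> by simp
    show cl: "closed (range T)"
      using closed_range_if_closed_range_cadjoint_comp[OF T]
        closed_range_shift_op[OF A K' a0] by (simp only: shift0)
    obtain C where C: "bounded_clinear ?K" "finite C" "range ?K = cspan C"
      using finite_rankE[OF K] by blast
    have "null_space T \<subseteq> null_space (shift_op (cadjoint T \<circ> T) 0)"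
      unfolding shift0 by (auto simp: null_space_def bounded_clinear_zero[OF bT'])
    also have "\<dots> \<subseteq> cspan C"
      using eigenspace_subset_range[where A = "cadjoint T \<circ> T", OF finite_rank_bounded_clinear[OF K'] a0] C(3)
      by (simp only: comp_apply)
    finally have "null_space T \<subseteq> cspan C" .
    then show fin: "finite_cdim (null_space T)"
      by (rule finite_cdim_mono[OF finite_cdim_span[OF C(2)] subspace_null_space[OF T]])
    have bS: "bounded_clinear ?S" and sa: "self_adjoint (T \<circ> ?S)" and TST: "T \<circ> ?S \<circ> T = T"
      and STS: "?S \<circ> T \<circ> ?S = ?S"
      using mp_inverse_properties[OF T cl] by blast+
    have T'TS: "cadjoint T (T (?S y)) = cadjoint T y" for y
    proof (rule cinner_ext)
      fix z
      have "cinner (T (?S y)) (T z) = cinner y (T z)"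
        using self_adjoint_cinner[OF sa, of y "T z"] fun_cong[OF TST, of z] by simp
      then show "cinner (cadjoint T (T (?S y))) z = cinner (cadjoint T y) z"
        by (simp add: cinner_cadjoint'[OF T])
    qed
    have "finite_rank ((\<lambda>x. ?K x - ?a *\<^sub>C (x - ?S (T x))) \<circ> ?S)"
      by (intro finite_rank_comp_right finite_rank_diff finite_rank_scale K Q cl fin bS)
    moreover have "(\<lambda>x. ?K x - ?a *\<^sub>C (x - ?S (T x))) \<circ> ?S = ?G"
      using fun_cong[OF STS] by (auto simp: T'TS)
    ultimately show "finite_rank ?G" by simp
  next
    assume *: "closed (range T) \<and> finite_cdim (null_space T) \<and> finite_rank ?G"
    then have "finite_rank (\<lambda>x. (?G \<circ> T) x + ?a *\<^sub>C (x - ?S (T x)))"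
      by (intro finite_rank_add finite_rank_scale finite_rank_comp_right T Q) auto
    moreover have "(\<lambda>x. (?G \<circ> T) x + ?a *\<^sub>C (x - ?S (T x))) = ?K"
      by (simp add: complex_vector.scale_right_diff_distrib)
    ultimately show "finite_rank ?K" by simp
  qed
qed

section \<open>The equivalence\<close>

theorem theorem2p15:
  fixes T :: "'h::chilbert_space \<Rightarrow> 'h"
  assumes "\<not> finite_cdim (UNIV :: 'h set)"
    and "separable_space (euclidean :: 'h topology)"
    and "bounded_clinear T"
  defines "statement1 \<equiv> \<exists>\<alpha>::real. \<alpha> > 0 \<and>
      ess_spectrum (cadjoint T \<circ> T) = {complex_of_real \<alpha>} \<and>
      finite {(\<mu>, i) \<in> discrete_eigenvalues_mult (cadjoint T \<circ> T). \<mu> \<noteq> complex_of_real \<alpha>}"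
    and "statement2 \<equiv> \<exists>(\<alpha>::real) F V. \<alpha> > 0 \<and> finite_rank F \<and>
      partial_isometry V \<and> finite_cdim (null_space V) \<and>
      T = (\<lambda>x. F x + complex_of_real (sqrt \<alpha>) *\<^sub>C V x)"
    and "statement3 \<equiv> \<exists>\<alpha>::real. \<alpha> > 0 \<and>
      finite_rank (\<lambda>x. complex_of_real \<alpha> *\<^sub>C x - cadjoint T (T x))"
    and "statement4 \<equiv> closed (range T) \<and> finite_cdim (null_space T) \<and>
      (\<exists>\<alpha>::real. \<alpha> > 0 \<and>
        finite_rank (\<lambda>x. complex_of_real \<alpha> *\<^sub>C mp_inverse T x - cadjoint T x))"
  shows "(statement1 \<longleftrightarrow> statement2) \<and> (statement2 \<longleftrightarrow> statement3) \<and> (statement3 \<longleftrightarrow> statement4)"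
proof -
  note T = assms(3)
  note A = self_adjoint_cadjoint_comp[OF T]
  let ?K = "\<lambda>\<alpha> x. complex_of_real \<alpha> *\<^sub>C x - cadjoint T (T x)"
  have "ess_spectrum (cadjoint T \<circ> T) = {complex_of_real \<alpha>} \<and>
      finite {(\<mu>, i) \<in> discrete_eigenvalues_mult (cadjoint T \<circ> T). \<mu> \<noteq> complex_of_real \<alpha>}
      \<longleftrightarrow> finite_rank (?K \<alpha>)" for \<alpha>
    using finite_rank_if_ess_spectrum_singleton[OF A, of \<alpha>]
      ess_spectrum_singleton_if_finite_rank[OF assms(1) A, of \<alpha>] by auto
  then have 13: "statement1 \<longleftrightarrow> statement3"
    unfolding statement1_def statement3_def by simp
  have "(\<exists>F V. finite_rank F \<and> partial_isometry V \<and> finite_cdim (null_space V) \<and>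
      T = (\<lambda>x. F x + complex_of_real (sqrt \<alpha>) *\<^sub>C V x)) \<longleftrightarrow> finite_rank (?K \<alpha>)" if "\<alpha> > 0" for \<alpha>
    using finite_rank_iff_scales_on_orth_compl[OF T]
      scales_on_orth_compl_iff_partial_isometry[OF T that] by simp
  then have 23: "statement2 \<longleftrightarrow> statement3"
    unfolding statement2_def statement3_def by blast
  have 34: "statement3 \<longleftrightarrow> statement4"
    unfolding statement3_def statement4_def using finite_rank_iff_mp_inverse[OF T] by blast
  show ?thesis using 13 23 34 by blast
qed

end
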